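(* Let $(M,g)$ be the Robinson–Trautman spacetime with coordinates $(t,r,x,y)$, constants $a,b,d\in\mathbb R$ and function $f=f(x,y)$, and let $F_1=f_x^2+f_y^2-f(f_{xx}+f_{yy})$. If $F_1-2a+4br\neq0$ and $rF_1+6d-2ar\neq0$, then the spacetime possesses generalized curvature inheritance with respect to the vector field $\xi=\frac{\partial}{\partial x}$, given by $$\mathscr L_\xi R=\lambda_R R+\lambda_1\,g\wedge g+\lambda_2\,g\wedge S,$$ where $$\lambda_R=-\frac{F_4}{f(-6d+2ar-rF_1)},$$ $$\lambda_1=-\frac{8b(-d+2br^2)f_x}{r^2f(F_1-2a+4br)}+\frac{(2ad-16bdr+8b^2r^3-dF_1)F_4}{r^3f(F_1-2a+4br)(-6d+2ar-rF_1)},$$ $$\lambda_2=-\frac{2b(-d+2br^2)f_x}{rf(F_1-2a+4br)}+\frac{(-3d+2br^2)F_4}{rf(F_1-2a+4br)(-6d+2ar-rF_1)},$$ $$F_4=(-12d+8ar-8br^2)f_x-4rf_y^2f_x+3rff_{yy}f_x-4rf_x^3+2rff_yf_{xy}-rf^2f_{xyy}+5rff_xf_{xx}-rf^2f_{xxx}.$$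
   Context: Robinson–Trautman (RT) spacetime: $a,b,d\in\mathbb R$ are constants; $M=I\times J\times\Omega$ with coordinates $(x^1,x^2,x^3,x^4)=(t,r,x,y)$, where $I\subset\mathbb R$ and $J\subset\mathbb R\setminus\{0\}$ are open intervals and $\Omega\subset\mathbb R^2$ is open, connected and nonempty; $f:\Omega\to\mathbb R$ is smooth and nowhere vanishing, with subscripts denoting partial derivatives; the metric is $$g=-2\Big(a-2br-\frac dr\Big)dt^2+2\,dt\,dr-\frac{r^2}{f^2}(dx^2+dy^2).$$ ($2\,dt\,dr$ means $g_{12}=g_{21}=1$.) Curvature conventions: with $\Gamma$ the Levi-Civita connection coefficients, $R_{pqrs}=g_{p\alpha}(\partial_r\Gamma^\alpha_{qs}-\partial_s\Gamma^\alpha_{qr}+\Gamma^\beta_{qs}\Gamma^\alpha_{\beta r}-\Gamma^\beta_{qr}\Gamma^\alpha_{\beta s})$ is the type $(0,4)$ Riemann tensor and $S_{qr}=g^{ps}R_{pqrs}$ is the Ricci tensor. With this convention $R_{1212}=-\frac{2d}{r^3}$ and the nonzero components of $S$ (up to symmetry) are $S_{11}=-\frac{8b(d+r(-a+2br))}{r^2}$, $S_{12}=-\frac{4b}{r}$, $S_{33}=S_{44}=\frac{F_1-2a+8br}{f^2}$. The Kulkarni–Nomizu product of symmetric $(0,2)$ tensors is $(\phi\wedge\psi)_{pqrs}=\phi_{ps}\psi_{qr}-\phi_{pr}\psi_{qs}+\phi_{qr}\psi_{ps}-\phi_{qs}\psi_{pr}$. Generalized curvature inheritance with respect to $\xi$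 means $\mathscr L_\xi R=\lambda R+\lambda_1 g\wedge g+\lambda_2 g\wedge S$ for smooth functions $\lambda,\lambda_1,\lambda_2$, where $\mathscr L_\xi$ is the Lie derivative of the $(0,4)$ tensor.
   Formalization: In the first summand of λ_2 the factor b is removed: it reads -2(-d+2br^2)f_x/(rf(F_1-2a+4br)); as printed, with 2b, the identity fails, e.g. for f=e^x, a=0, d=1, b=2, 1<r<2. *)

theory Defs
  imports "HOL-Analysis.Analysis"
begin

definition partial :: "'n::finite \<Rightarrow> (real^'n \<Rightarrow> real) \<Rightarrow> real^'n \<Rightarrow> real" where
  "partial i h p = deriv (\<lambda>s. h (p + s *\<^sub>R axis i 1)) 0"

text \<open>
  \<open>C\<^sup>\<infinity>\<close> on an open set: the iterated partial derivatives of every order (including order 0)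
  exist and are continuous. Existence is required separately because \<^const>\<open>deriv\<close> is total.
\<close>

definition smooth_on :: "(real^'n::finite) set \<Rightarrow> (real^'n \<Rightarrow> real) \<Rightarrow> bool" where
  "smooth_on U h \<longleftrightarrow>
     (\<forall>ks. continuous_on U (foldr partial ks h) \<and>
        (\<forall>i. \<forall>p\<in>U. (\<lambda>s. foldr partial ks h (p + s *\<^sub>R axis i 1)) differentiable (at 0)))"

text \<open>
  Tensor fields are given by their components in the standard coordinates of \<open>real^'n\<close>;
  a metric is a matrix-valued function.
\<close>

type_synonym 'n tensor4 = "real^'n \<Rightarrow> 'n \<Rightarrow> 'n \<Rightarrow> 'n \<Rightarrow> 'n \<Rightarrow> real"

text \<open>\<open>christoffel g k i j p\<close> is \<open>\<Gamma>\<^sup>k\<^sub>i\<^sub>j(p)\<close>.\<close>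

definition christoffel ::
    "(real^'n::finite \<Rightarrow> real^'n^'n) \<Rightarrow> 'n \<Rightarrow> 'n \<Rightarrow> 'n \<Rightarrow> real^'n \<Rightarrow> real" where
  "christoffel g k i j p =
     (\<Sum>l\<in>UNIV. matrix_inv (g p) $ k $ l *
        (partial i (\<lambda>x. g x $ l $ j) p + partial j (\<lambda>x. g x $ l $ i) p
          - partial l (\<lambda>x. g x $ i $ j) p)) / 2"

definition riemann :: "(real^'n::finite \<Rightarrow> real^'n^'n) \<Rightarrow> 'n tensor4" where
  "riemann g x p q r s =
     (\<Sum>\<alpha>\<in>UNIV. g x $ p $ \<alpha> *
        (partial r (christoffel g \<alpha> q s) x - partial s (christoffel g \<alpha> q r) x
          + (\<Sum>\<beta>\<in>UNIV. christoffel g \<beta> q s x * christoffel g \<alpha> \<beta> r x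
                     - christoffel g \<beta> q r x * christoffel g \<alpha> \<beta> s x)))"

definition ricci :: "(real^'n::finite \<Rightarrow> real^'n^'n) \<Rightarrow> real^'n \<Rightarrow> real^'n^'n" where
  "ricci g x = (\<chi> q r. \<Sum>p\<in>UNIV. \<Sum>s\<in>UNIV. matrix_inv (g x) $ p $ s * riemann g x p q r s)"

definition kulkarni_nomizu ::
    "(real^'n \<Rightarrow> real^'n^'n) \<Rightarrow> (real^'n \<Rightarrow> real^'n^'n) \<Rightarrow> 'n::finite tensor4" where
  "kulkarni_nomizu \<phi> \<psi> x p q r s =
     \<phi> x $ p $ s * \<psi> x $ q $ r - \<phi> x $ p $ r * \<psi> x $ q $ s
     + \<phi> x $ q $ r * \<psi> x $ p $ s - \<phi> x $ q $ s * \<psi> x $ p $ r"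

definition lie_derivative :: "(real^'n \<Rightarrow> real^'n) \<Rightarrow> 'n::finite tensor4 \<Rightarrow> 'n tensor4" where
  "lie_derivative \<xi> T x p q r s =
     (\<Sum>m\<in>UNIV. \<xi> x $ m * partial m (\<lambda>y. T y p q r s) x
        + T x m q r s * partial p (\<lambda>y. \<xi> y $ m) x
        + T x p m r s * partial q (\<lambda>y. \<xi> y $ m) x
        + T x p q m s * partial r (\<lambda>y. \<xi> y $ m) x
        + T x p q r m * partial s (\<lambda>y. \<xi> y $ m) x)"

definition generalized_curvature_inheritance ::
    "(real^'n::finite) set \<Rightarrow> (real^'n \<Rightarrow> real^'n^'n) \<Rightarrow> (real^'n \<Rightarrow> real^'n) \<Rightarrow>
     (real^'n \<Rightarrow> real) \<Rightarrow> (real^'n \<Rightarrow> real) \<Rightarrow> (real^'n \<Rightarrow> real) \<Rightarrow> bool" where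
  "generalized_curvature_inheritance M g \<xi> lam lam1 lam2 \<longleftrightarrow>
     smooth_on M lam \<and> smooth_on M lam1 \<and> smooth_on M lam2 \<and>
     (\<forall>x\<in>M. \<forall>p q r s.
        lie_derivative \<xi> (riemann g) x p q r s =
          lam x * riemann g x p q r s
          + lam1 x * kulkarni_nomizu g g x p q r s
          + lam2 x * kulkarni_nomizu g (ricci g) x p q r s)"

text \<open>
  The Robinson--Trautman spacetime. A point of \<open>real^4\<close> has coordinates \<open>(t, r, x, y)\<close>, and
  \<open>xy p\<close> is its \<open>(x, y)\<close> part. In the index type \<open>4\<close> the numeral \<open>4\<close> is the same element as \<open>0\<close>,
  so \<open>1, 2, 3, 4\<close> are the four distinct indices.
\<close>

definition xy :: "real^4 \<Rightarrow> real^2" where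
  "xy p = vector [p $ 3, p $ 4]"

definition RT_domain :: "real set \<Rightarrow> real set \<Rightarrow> (real^2) set \<Rightarrow> (real^4) set" where
  "RT_domain I J \<Omega> = {p. p $ 1 \<in> I \<and> p $ 2 \<in> J \<and> xy p \<in> \<Omega>}"

definition RT_metric ::
    "real \<Rightarrow> real \<Rightarrow> real \<Rightarrow> (real^2 \<Rightarrow> real) \<Rightarrow> real^4 \<Rightarrow> real^4^4" where
  "RT_metric a b d f p =
     (let r = p $ 2; h = - (r\<^sup>2 / (f (xy p))\<^sup>2) in
      vector [vector [- 2 * (a - 2 * b * r - d / r), 1, 0, 0],
              vector [1, 0, 0, 0],
              vector [0, 0, h, 0],
              vector [0, 0, 0, h]])"

definition RT_F1 :: "(real^2 \<Rightarrow> real) \<Rightarrow> real^2 \<Rightarrow> real" where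
  "RT_F1 f z =
     (let fx = partial 1 f; fy = partial 2 f; fxx = partial 1 fx; fyy = partial 2 fy in
      (fx z)\<^sup>2 + (fy z)\<^sup>2 - f z * (fxx z + fyy z))"

definition RT_F4 ::
    "real \<Rightarrow> real \<Rightarrow> real \<Rightarrow> (real^2 \<Rightarrow> real) \<Rightarrow> real \<Rightarrow> real^2 \<Rightarrow> real" where
  "RT_F4 a b d f r z =
     (let fx = partial 1 f; fy = partial 2 f;
          fxx = partial 1 fx; fxy = partial 2 fx; fyy = partial 2 fy;
          fxxx = partial 1 fxx; fxyy = partial 2 fxy in
      (- 12 * d + 8 * a * r - 8 * b * r\<^sup>2) * fx z - 4 * r * (fy z)\<^sup>2 * fx z
      + 3 * r * f z * fyy z * fx z - 4 * r * (fx z) ^ 3 + 2 * r * f z * fy z * fxy z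
      - r * (f z)\<^sup>2 * fxyy z + 5 * r * f z * fx z * fxx z - r * (f z)\<^sup>2 * fxxx z)"

definition RT_lam ::
    "real \<Rightarrow> real \<Rightarrow> real \<Rightarrow> (real^2 \<Rightarrow> real) \<Rightarrow> real^4 \<Rightarrow> real" where
  "RT_lam a b d f p =
     (let r = p $ 2; z = xy p; F1 = RT_F1 f z; F4 = RT_F4 a b d f r z in
      - (F4 / (f z * (- 6 * d + 2 * a * r - r * F1))))"

definition RT_lam1 ::
    "real \<Rightarrow> real \<Rightarrow> real \<Rightarrow> (real^2 \<Rightarrow> real) \<Rightarrow> real^4 \<Rightarrow> real" where
  "RT_lam1 a b d f p =
     (let r = p $ 2; z = xy p; fx = partial 1 f z; F1 = RT_F1 f z; F4 = RT_F4 a b d f r z in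
      - (8 * b * (- d + 2 * b * r\<^sup>2) * fx / (r\<^sup>2 * f z * (F1 - 2 * a + 4 * b * r)))
      + (2 * a * d - 16 * b * d * r + 8 * b\<^sup>2 * r ^ 3 - d * F1) * F4
        / (r ^ 3 * f z * (F1 - 2 * a + 4 * b * r) * (- 6 * d + 2 * a * r - r * F1)))"

text \<open>
  The first summand of \<open>\<lambda>\<^sub>2\<close> is sometimes given with numerator \<open>2b(-d + 2br\<^sup>2)f\<^sub>x\<close>. The factor \<open>b\<close>
  there is a misprint: since \<open>R\<^sub>1\<^sub>2\<^sub>1\<^sub>2 = -2d/r\<^sup>3\<close>, \<open>(g \<and> g)\<^sub>1\<^sub>2\<^sub>1\<^sub>2 = 2\<close>, \<open>(g \<and> S)\<^sub>1\<^sub>2\<^sub>1\<^sub>2 = -8b/r\<close>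
  and \<open>(\<L>\<^sub>\<xi> R)\<^sub>1\<^sub>2\<^sub>1\<^sub>2 = 0\<close> for \<open>\<xi> = \<partial>/\<partial>x\<close>, the (1,2,1,2) component of the inheritance equation reads
  \<open>(4b/r) \<lambda>\<^sub>2 = \<lambda>\<^sub>1 - (d/r\<^sup>3) \<lambda>\<close>, which forces the form below.
\<close>

definition RT_lam2 ::
    "real \<Rightarrow> real \<Rightarrow> real \<Rightarrow> (real^2 \<Rightarrow> real) \<Rightarrow> real^4 \<Rightarrow> real" where
  "RT_lam2 a b d f p =
     (let r = p $ 2; z = xy p; fx = partial 1 f z; F1 = RT_F1 f z; F4 = RT_F4 a b d f r z in
      - (2 * (- d + 2 * b * r\<^sup>2) * fx / (r * f z * (F1 - 2 * a + 4 * b * r)))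
      + (- 3 * d + 2 * b * r\<^sup>2) * F4
        / (r * f z * (F1 - 2 * a + 4 * b * r) * (- 6 * d + 2 * a * r - r * F1)))"

end

theory Submission
  imports Defs
begin

text \<open>
  Write \<open>A = g\<^sub>1\<^sub>1\<close>, let \<open>\<gamma>\<close> be the \<open>(t, r)\<close> block of the metric and let
  \<open>\<sigma> = (dx\<^sup>2 + dy\<^sup>2) / f\<^sup>2\<close>. Then \<open>g = \<gamma> - r\<^sup>2 \<sigma>\<close> is a warped product with
  two-dimensional factors, and two consequences of this carry the proof. The curvature
  tensor is a combination of three Kulkarni--Nomizu products (\<open>riemann_RT\<close>),
  \<open>R = - (A''/4) \<gamma> \<and> \<gamma> + (r A'/2) \<gamma> \<and> \<sigma> - (r\<^sup>2 (F\<^sub>1 + A)/2) \<sigma> \<and> \<sigma>\<close>,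
  and the Ricci tensor is a combination of \<open>\<gamma>\<close> and \<open>\<sigma>\<close> (\<open>ricci_RT\<close>). By bilinearity \<open>g \<and> g\<close>
  and \<open>g \<and> S\<close> lie in the span of the same three products. So does \<open>\<L>\<^sub>\<xi> R\<close> for
  \<open>\<xi> = \<partial>/\<partial>x\<close>, because \<open>\<L>\<^sub>\<xi> \<gamma> = 0\<close> and \<open>\<L>\<^sub>\<xi> \<sigma> = - (2 f\<^sub>x / f) \<sigma>\<close>
  (\<open>lie_derivative_riemann_RT\<close>).

  The inheritance equation therefore amounts to three scalar linear equations for the three
  unknowns \<open>\<lambda>\<close>, \<open>\<lambda>\<^sub>1\<close>, \<open>\<lambda>\<^sub>2\<close>. Elimination divides by \<open>F\<^sub>1 - 2a + 4br\<close> and by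
  \<open>r F\<^sub>1 + 6d - 2ar\<close>, which is where the two hypotheses enter, and it returns the given
  functions (\<open>inheritance_coefficients\<close>). The quantity \<open>F\<^sub>4\<close> is
  \<open>r f \<partial>\<^sub>x F\<^sub>1 - 4 r f\<^sub>x F\<^sub>1 + (8ar - 12d - 8br\<^sup>2) f\<^sub>x\<close> (\<open>F4_eq\<close>).

  Two pieces of analysis are needed as well. The mixed partial derivatives of \<open>f\<close> have to
  commute, both in the curvature and in \<open>\<partial>\<^sub>x F\<^sub>1\<close> (\<open>partial_commute\<close>), and the three
  functions have to be smooth; \<open>smooth_on_coinduct\<close> reduces the latter to closure of a class
  of functions under one partial derivative.
\<close>

section \<open>Partial derivatives\<close>

text \<open>
  Relational counterpart of \<^const>\<open>partial\<close>: it includes the existence of the derivative, so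
  that the usual differentiation rules hold without side conditions on differentiability.
\<close>

definition has_partial :: "'n::finite \<Rightarrow> (real^'n \<Rightarrow> real) \<Rightarrow> real \<Rightarrow> real^'n \<Rightarrow> bool" where
  "has_partial m h D p \<longleftrightarrow> ((\<lambda>s. h (p + s *\<^sub>R axis m 1)) has_real_derivative D) (at 0)"

lemma has_partial_imp_partial: "has_partial m h D p \<Longrightarrow> partial m h p = D"
  unfolding has_partial_def partial_def by (rule DERIV_imp_deriv)

lemma has_partial_eq_rhs: "has_partial m h D p \<Longrightarrow> D = D' \<Longrightarrow> has_partial m h D' p"
  by simp

lemma has_partial_const: "has_partial m (\<lambda>_. c) 0 p"
  unfolding has_partial_def by (auto intro!: derivative_eq_intros)

lemma has_partial_coord: "has_partial m (\<lambda>p. p $ i) (axis m 1 $ i) p"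
  unfolding has_partial_def by (auto intro!: derivative_eq_intros)

lemma has_partial_add:
  "has_partial m h D p \<Longrightarrow> has_partial m k E p \<Longrightarrow> has_partial m (\<lambda>q. h q + k q) (D + E) p"
  unfolding has_partial_def by (rule DERIV_add)

lemma has_partial_diff:
  "has_partial m h D p \<Longrightarrow> has_partial m k E p \<Longrightarrow> has_partial m (\<lambda>q. h q - k q) (D - E) p"
  unfolding has_partial_def by (rule DERIV_diff)

lemma has_partial_minus:
  "has_partial m h D p \<Longrightarrow> has_partial m (\<lambda>q. - h q) (- D) p"
  unfolding has_partial_def by (rule DERIV_minus)

lemma has_partial_mult:
  "has_partial m h D p \<Longrightarrow> has_partial m k E p \<Longrightarrow>
    has_partial m (\<lambda>q. h q * k q) (D * k p + h p * E) p"
  unfolding has_partial_def by (auto intro!: derivative_eq_intros)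

lemma has_partial_power:
  "has_partial m h D p \<Longrightarrow> has_partial m (\<lambda>q. h q ^ n) (of_nat n * (D * h p ^ (n - Suc 0))) p"
  unfolding has_partial_def by (auto intro!: derivative_eq_intros)

lemma has_partial_divide:
  "has_partial m h D p \<Longrightarrow> has_partial m k E p \<Longrightarrow> k p \<noteq> 0 \<Longrightarrow>
    has_partial m (\<lambda>q. h q / k q) ((D * k p - h p * E) / (k p * k p)) p"
  unfolding has_partial_def by (auto intro!: derivative_eq_intros)

lemma has_partial_inverse:
  "has_partial m h D p \<Longrightarrow> h p \<noteq> 0 \<Longrightarrow>
    has_partial m (\<lambda>q. inverse (h q)) (- (D * (inverse (h p) * inverse (h p)))) p"
  unfolding has_partial_def by (auto intro!: derivative_eq_intros)

lemmas has_partial_intros =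
  has_partial_const has_partial_coord has_partial_add has_partial_diff has_partial_minus
  has_partial_mult has_partial_power has_partial_divide

lemma eventually_axis_line_in_open:
  fixes U :: "(real^'n::finite) set"
  assumes "open U" "p \<in> U"
  shows "\<forall>\<^sub>F s in nhds 0. p + s *\<^sub>R axis m 1 \<in> U"
proof -
  have "((\<lambda>s::real. p + s *\<^sub>R axis m 1) \<longlongrightarrow> p + 0 *\<^sub>R axis m 1) (nhds 0)"
    by (intro tendsto_add tendsto_scaleR tendsto_const filterlim_ident)
  then show ?thesis using assms by (auto dest!: topological_tendstoD)
qed

text \<open>
  Derivatives are local, so a formula that is valid on an open set only, such as the one for
  the connection coefficients below, can be differentiated there.
\<close>

lemma has_partial_cong:
  assumes "open U" "p \<in> U" and eq: "\<And>q. q \<in> U \<Longrightarrow> h q = k q"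
  shows "has_partial m h D p \<longleftrightarrow> has_partial m k D p"
  unfolding has_partial_def
proof (rule DERIV_cong_ev)
  show "\<forall>\<^sub>F s in nhds 0. h (p + s *\<^sub>R axis m 1) = k (p + s *\<^sub>R axis m 1)"
    using eventually_axis_line_in_open[OF assms(1,2)] by eventually_elim (rule eq)
qed auto

lemma partial_cong:
  assumes "open U" "p \<in> U" and eq: "\<And>q. q \<in> U \<Longrightarrow> h q = k q"
  shows "partial m h p = partial m k p"
  unfolding partial_def
proof (rule deriv_cong_ev)
  show "\<forall>\<^sub>F s in nhds 0. h (p + s *\<^sub>R axis m 1) = k (p + s *\<^sub>R axis m 1)"
    using eventually_axis_line_in_open[OF assms(1,2)] by eventually_elim (rule eq)
qed auto

section \<open>Smooth functions\<close>

lemma smooth_on_has_partial: "smooth_on U h \<Longrightarrow> p \<in> U \<Longrightarrow> has_partial m h (partial m h p) p"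
  unfolding smooth_on_def has_partial_def partial_def
  by (drule spec[of _ "[]"]) (auto simp: DERIV_deriv_iff_real_differentiable)

lemma smooth_on_imp_continuous_on: "smooth_on U h \<Longrightarrow> continuous_on U h"
  unfolding smooth_on_def by (drule spec[of _ "[]"]) auto

text \<open>
  The last index of the list is the one applied first, so appending \<open>m\<close> to the list
  differentiates \<open>partial m h\<close>.
\<close>

lemma smooth_on_partial: "smooth_on U h \<Longrightarrow> smooth_on U (partial m h)"
  unfolding smooth_on_def
proof
  fix ks assume h: "\<forall>ks. continuous_on U (foldr partial ks h) \<and>
        (\<forall>i. \<forall>p\<in>U. (\<lambda>s. foldr partial ks h (p + s *\<^sub>R axis i 1)) differentiable (at 0))"
  show "continuous_on U (foldr partial ks (partial m h)) \<and>
        (\<forall>i. \<forall>p\<in>U. (\<lambda>s. foldr partial ks (partial m h) (p + s *\<^sub>R axis i 1)) differentiable (at 0))"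
    using h[rule_format, of "ks @ [m]"] by simp
qed

text \<open>
  Smoothness is the largest property of continuous functions that passes to all first partial
  derivatives. The derivative only has to agree on \<open>U\<close> with a function in the class,
  because \<open>U\<close> is open; this makes room for the values that \<^const>\<open>partial\<close> takes outside \<open>U\<close>.
\<close>

lemma smooth_on_coinduct:
  assumes "open U" "P h"
    and step: "\<And>h. P h \<Longrightarrow>
      continuous_on U h \<and> (\<forall>m. \<exists>h'. P h' \<and> (\<forall>p\<in>U. has_partial m h (h' p) p))"
  shows "smooth_on U h"
proof -
  have ex: "\<exists>k. P k \<and> (\<forall>p\<in>U. foldr partial ks h p = k p)" for ks
  proof (induction ks)
    case Nil
    then show ?case using \<open>P h\<close> by auto
  next
    case (Cons m ks)
    then obtain k where "P k" and k: "\<forall>p\<in>U. foldr partial ks h p = k p" by blast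
    obtain k' where "P k'" and k': "\<forall>p\<in>U. has_partial m k (k' p) p"
      using step[OF \<open>P k\<close>] by blast
    have "foldr partial (m # ks) h p = k' p" if "p \<in> U" for p
      using partial_cong[OF \<open>open U\<close> that, of "foldr partial ks h" k m] k
        has_partial_imp_partial[OF bspec[OF k' that]] by auto
    with \<open>P k'\<close> show ?case by blast
  qed
  show ?thesis unfolding smooth_on_def
  proof (intro allI conjI ballI)
    fix ks
    obtain k where "P k" and k: "\<forall>p\<in>U. foldr partial ks h p = k p" using ex by blast
    show "continuous_on U (foldr partial ks h)"
      using step[OF \<open>P k\<close>] k by (auto cong: continuous_on_cong)
    fix i p assume "p \<in> U"
    obtain k' where "has_partial i k (k' p) p" using step[OF \<open>P k\<close>] \<open>p \<in> U\<close> by blast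
    then have "has_partial i (foldr partial ks h) (k' p) p"
      using has_partial_cong[OF \<open>open U\<close> \<open>p \<in> U\<close>, of "foldr partial ks h" k] k by simp
    then show "(\<lambda>s. foldr partial ks h (p + s *\<^sub>R axis i 1)) differentiable (at 0)"
      unfolding has_partial_def by (rule differentiableI[OF has_field_derivative_imp_has_derivative])
  qed
qed

lemma smooth_on_const:
  assumes "open U" shows "smooth_on U (\<lambda>_. c)"
  by (rule smooth_on_coinduct[where P = "\<lambda>h. \<exists>c. h = (\<lambda>_. c)"])
     (use assms has_partial_const in \<open>auto intro!: exI[of _ "\<lambda>_. 0"]\<close>)

lemma smooth_on_coord:
  assumes "open U" shows "smooth_on U (\<lambda>p. p $ i)"
proof (rule smooth_on_coinduct[where P = "\<lambda>h. h = (\<lambda>p. p $ i) \<or> (\<exists>c. h = (\<lambda>_. c))"])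
  show "continuous_on U h \<and> (\<forall>m. \<exists>h'. (h' = (\<lambda>p. p $ i) \<or> (\<exists>c. h' = (\<lambda>_. c))) \<and>
      (\<forall>p\<in>U. has_partial m h (h' p) p))"
    if "h = (\<lambda>p. p $ i) \<or> (\<exists>c. h = (\<lambda>_. c))" for h :: "real^'a \<Rightarrow> real"
    using that
  proof
    assume h: "h = (\<lambda>p. p $ i)"
    show ?thesis unfolding h
      by (intro conjI allI continuous_intros, rule_tac x = "\<lambda>_. axis m 1 $ i" in exI)
         (auto intro: has_partial_coord)
  next
    assume "\<exists>c. h = (\<lambda>_. c)"
    then obtain c where h: "h = (\<lambda>_. c)" ..
    show ?thesis unfolding h
      by (intro conjI allI continuous_intros, rule_tac x = "\<lambda>_. 0" in exI)
         (auto intro: has_partial_const)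
  qed
qed (use assms in auto)

text \<open>
  The algebra generated by the smooth functions, closed under reciprocals. By the Leibniz rule
  it is stable under partial derivatives, hence all its members are smooth; this gives the
  closure properties of smoothness without any formula for higher derivatives of products.
\<close>

inductive smooth_algebra :: "(real^'n::finite) set \<Rightarrow> (real^'n \<Rightarrow> real) \<Rightarrow> bool" for U where
  base: "smooth_on U h \<Longrightarrow> smooth_algebra U h"
| add: "smooth_algebra U h \<Longrightarrow> smooth_algebra U k \<Longrightarrow> smooth_algebra U (\<lambda>p. h p + k p)"
| mult: "smooth_algebra U h \<Longrightarrow> smooth_algebra U k \<Longrightarrow> smooth_algebra U (\<lambda>p. h p * k p)"
| inverse: "smooth_algebra U h \<Longrightarrow> \<forall>p\<in>U. h p \<noteq> 0 \<Longrightarrow> smooth_algebra U (\<lambda>p. inverse (h p))"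

lemma smooth_algebra_imp_smooth_on:
  assumes "open U" "smooth_algebra U h"
  shows "smooth_on U h"
proof (rule smooth_on_coinduct[where P = "smooth_algebra U"])
  fix h assume "smooth_algebra U h"
  then show "continuous_on U h \<and>
    (\<forall>m. \<exists>h'. smooth_algebra U h' \<and> (\<forall>p\<in>U. has_partial m h (h' p) p))"
  proof induction
    case (base h)
    then show ?case
      by (meson smooth_algebra.base smooth_on_has_partial smooth_on_imp_continuous_on smooth_on_partial)
  next
    case (add h k)
    have "\<exists>h'. smooth_algebra U h' \<and> (\<forall>p\<in>U. has_partial m (\<lambda>p. h p + k p) (h' p) p)" for m
    proof -
      obtain h' k' where "smooth_algebra U h'" "\<forall>p\<in>U. has_partial m h (h' p) p"
        "smooth_algebra U k'" "\<forall>p\<in>U. has_partial m k (k' p) p" using add.IH by metis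
      then show ?thesis
        by (intro exI[of _ "\<lambda>p. h' p + k' p"]) (auto intro: has_partial_add smooth_algebra.add)
    qed
    then show ?case using add.IH by (auto intro: continuous_intros)
  next
    case (mult h k)
    have "\<exists>h'. smooth_algebra U h' \<and> (\<forall>p\<in>U. has_partial m (\<lambda>p. h p * k p) (h' p) p)" for m
    proof -
      obtain h' k' where "smooth_algebra U h'" "\<forall>p\<in>U. has_partial m h (h' p) p"
        "smooth_algebra U k'" "\<forall>p\<in>U. has_partial m k (k' p) p" using mult.IH by metis
      then show ?thesis using mult.hyps
        by (intro exI[of _ "\<lambda>p. h' p * k p + h p * k' p"])
           (auto intro: has_partial_mult smooth_algebra.intros(2,3))
    qed
    then show ?case using mult.IH by (auto intro: continuous_intros)
  next
    case (inverse h)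
    have "\<exists>h'. smooth_algebra U h' \<and> (\<forall>p\<in>U. has_partial m (\<lambda>p. inverse (h p)) (h' p) p)" for m
    proof -
      obtain h' where h': "smooth_algebra U h'" "\<forall>p\<in>U. has_partial m h (h' p) p"
        using inverse.IH by metis
      have "smooth_algebra U (\<lambda>_. -1)" by (intro smooth_algebra.base smooth_on_const assms)
      then show ?thesis using inverse.hyps h'
        by (intro exI[of _ "\<lambda>p. - 1 * (h' p * (inverse (h p) * inverse (h p)))"] conjI
            smooth_algebra.mult smooth_algebra.inverse) (auto intro: has_partial_inverse)
    qed
    then show ?case using inverse by (auto intro: continuous_intros)
  qed
qed fact+

lemma smooth_on_add: "open U \<Longrightarrow> smooth_on U h \<Longrightarrow> smooth_on U k \<Longrightarrow> smooth_on U (\<lambda>p. h p + k p)"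
  by (rule smooth_algebra_imp_smooth_on) (auto intro: smooth_algebra.intros)

lemma smooth_on_mult: "open U \<Longrightarrow> smooth_on U h \<Longrightarrow> smooth_on U k \<Longrightarrow> smooth_on U (\<lambda>p. h p * k p)"
  by (rule smooth_algebra_imp_smooth_on) (auto intro: smooth_algebra.intros)

lemma smooth_on_inverse:
  "open U \<Longrightarrow> smooth_on U h \<Longrightarrow> \<forall>p\<in>U. h p \<noteq> 0 \<Longrightarrow> smooth_on U (\<lambda>p. inverse (h p))"
  by (rule smooth_algebra_imp_smooth_on) (auto intro: smooth_algebra.intros)

lemma smooth_on_minus: "open U \<Longrightarrow> smooth_on U h \<Longrightarrow> smooth_on U (\<lambda>p. - h p)"
  using smooth_on_mult[OF _ smooth_on_const[where c = "-1"]] by fastforce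

lemma smooth_on_diff: "open U \<Longrightarrow> smooth_on U h \<Longrightarrow> smooth_on U k \<Longrightarrow> smooth_on U (\<lambda>p. h p - k p)"
  using smooth_on_add[OF _ _ smooth_on_minus] by fastforce

lemma smooth_on_power: "open U \<Longrightarrow> smooth_on U h \<Longrightarrow> smooth_on U (\<lambda>p. h p ^ n)"
  by (induction n) (auto intro: smooth_on_const smooth_on_mult)

lemma smooth_on_divide:
  "open U \<Longrightarrow> smooth_on U h \<Longrightarrow> smooth_on U k \<Longrightarrow> \<forall>p\<in>U. k p \<noteq> 0 \<Longrightarrow> smooth_on U (\<lambda>p. h p / k p)"
  unfolding divide_inverse by (intro smooth_on_mult smooth_on_inverse)

lemmas smooth_on_intros =
  smooth_on_const smooth_on_coord smooth_on_add smooth_on_diff smooth_on_minus smooth_on_mult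
  smooth_on_power smooth_on_divide

section \<open>Symmetry of mixed partial derivatives\<close>

lemma has_partial_line:
  assumes "has_partial m h D (p + s *\<^sub>R axis m 1)"
  shows "((\<lambda>s. h (p + s *\<^sub>R axis m 1)) has_real_derivative D) (at s)"
proof -
  have "((\<lambda>t. h (p + (s + t) *\<^sub>R axis m 1)) has_real_derivative D) (at 0)"
    using assms unfolding has_partial_def by (simp add: scaleR_left_distrib add.assoc)
  then show ?thesis using DERIV_shift[of "\<lambda>s. h (p + s *\<^sub>R axis m 1)" D 0 s]
    by (simp add: add.commute)
qed

text \<open>
  The second difference of \<open>h\<close> over a square of side \<open>s\<close> is a difference of increments in the
  direction \<open>i\<close>; applying the mean value theorem to this increment and then in the
  direction \<open>j\<close> produces an intermediate value of the mixed derivative.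
\<close>

lemma second_difference_mean_value:
  assumes h: "smooth_on U h" and ball: "ball p e \<subseteq> U" and s: "0 < s" "2 * s < e"
  obtains \<sigma> \<tau> where "0 < \<sigma>" "\<sigma> < s" "0 < \<tau>" "\<tau> < s"
    "h (p + s *\<^sub>R axis i 1 + s *\<^sub>R axis j 1) - h (p + s *\<^sub>R axis i 1) - h (p + s *\<^sub>R axis j 1) + h p
      = s * (s * partial j (partial i h) (p + \<sigma> *\<^sub>R axis i 1 + \<tau> *\<^sub>R axis j 1))"
proof -
  have U: "p + x *\<^sub>R axis i 1 + y *\<^sub>R axis j 1 \<in> U" if "0 \<le> x" "x \<le> s" "0 \<le> y" "y \<le> s" for x y
  proof -
    have "norm (x *\<^sub>R axis i 1 + y *\<^sub>R axis j (1::real)) \<le> x + y"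
      using that by (intro norm_triangle_le) (simp add: norm_axis_1)
    then have "p + x *\<^sub>R axis i 1 + y *\<^sub>R axis j 1 \<in> ball p e"
      using that s by (simp add: dist_norm add.assoc norm_minus_cancel[of "x *\<^sub>R axis i 1 + y *\<^sub>R axis j 1", symmetric]
          del: norm_minus_cancel)
    then show ?thesis using ball by blast
  qed
  let ?u = "\<lambda>x. h (p + s *\<^sub>R axis j 1 + x *\<^sub>R axis i 1) - h (p + x *\<^sub>R axis i 1)"
  let ?u' = "\<lambda>x. partial i h (p + s *\<^sub>R axis j 1 + x *\<^sub>R axis i 1) - partial i h (p + x *\<^sub>R axis i 1)"
  have "(?u has_real_derivative ?u' x) (at x)" if "0 \<le> x" "x \<le> s" for x
    using U[of x s] U[of x 0] that s
    by (intro DERIV_diff has_partial_line smooth_on_has_partial[OF h]) (auto simp: add_ac)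
  from MVT2[OF s(1) this] obtain \<sigma> where \<sigma>: "0 < \<sigma>" "\<sigma> < s" "?u s - ?u 0 = s * ?u' \<sigma>" by auto
  have "((\<lambda>y. partial i h (p + \<sigma> *\<^sub>R axis i 1 + y *\<^sub>R axis j 1)) has_real_derivative
      partial j (partial i h) (p + \<sigma> *\<^sub>R axis i 1 + y *\<^sub>R axis j 1)) (at y)" if "0 \<le> y" "y \<le> s" for y
    using U[of \<sigma> y] that \<sigma>
    by (intro has_partial_line smooth_on_has_partial[OF smooth_on_partial[OF h]]) auto
  from MVT2[OF s(1) this] obtain \<tau> where \<tau>: "0 < \<tau>" "\<tau> < s"
    "?u' \<sigma> = s * partial j (partial i h) (p + \<sigma> *\<^sub>R axis i 1 + \<tau> *\<^sub>R axis j 1)"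
    by (auto simp: add_ac)
  show thesis
    using that[of \<sigma> \<tau>] \<sigma> \<tau> by (simp add: add_ac algebra_simps)
qed

text \<open>
  The second difference is symmetric in the two directions. It therefore equals \<open>s\<^sup>2\<close> times a
  value near \<open>p\<close> of either mixed derivative, and both are continuous.
\<close>

lemma partial_commute:
  assumes "open U" "p \<in> U" "smooth_on U h"
  shows "partial i (partial j h) p = partial j (partial i h) p"
proof -
  obtain e where e: "e > 0" "ball p e \<subseteq> U" using assms openE by blast
  have near: "\<exists>\<delta>>0. \<forall>x y. 0 < x \<and> x < \<delta> \<and> 0 < y \<and> y < \<delta> \<longrightarrow>
      \<bar>partial j (partial i h) (p + x *\<^sub>R axis i 1 + y *\<^sub>R axis j 1) - partial j (partial i h) p\<bar> < \<epsilon>"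
    if "\<epsilon> > 0" for \<epsilon> i j
  proof -
    have "continuous_on U (partial j (partial i h))"
      by (intro smooth_on_imp_continuous_on smooth_on_partial assms)
    then have "isCont (partial j (partial i h)) p"
      using assms continuous_on_eq_continuous_at by blast
    then obtain \<delta> where \<delta>: "\<delta> > 0" "\<forall>q. dist q p < \<delta> \<longrightarrow>
        dist (partial j (partial i h) q) (partial j (partial i h) p) < \<epsilon>"
      using \<open>\<epsilon> > 0\<close> unfolding continuous_at_eps_delta by blast
    have "dist (p + x *\<^sub>R axis i 1 + y *\<^sub>R axis j (1::real)) p < \<delta>"
      if "0 < x" "x < \<delta> / 2" "0 < y" "y < \<delta> / 2" for x y
    proof -
      have "norm (x *\<^sub>R axis i 1 + y *\<^sub>R axis j (1::real)) \<le> x + y"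
        using that by (intro norm_triangle_le) (simp add: norm_axis_1)
      then show ?thesis using that by (simp add: dist_norm add.assoc)
    qed
    then show ?thesis using \<delta> by (intro exI[of _ "\<delta> / 2"]) (auto simp: dist_real_def)
  qed
  have "\<bar>partial j (partial i h) p - partial i (partial j h) p\<bar> \<le> \<epsilon>" if \<epsilon>: "\<epsilon> > 0" for \<epsilon>
  proof -
    obtain \<delta>1 where \<delta>1: "\<delta>1 > 0" "\<And>x y. \<lbrakk>0 < x; x < \<delta>1; 0 < y; y < \<delta>1\<rbrakk> \<Longrightarrow>
      \<bar>partial j (partial i h) (p + x *\<^sub>R axis i 1 + y *\<^sub>R axis j 1) - partial j (partial i h) p\<bar> < \<epsilon> / 2"
      using near[OF half_gt_zero[OF \<epsilon>], of j i] by blast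
    obtain \<delta>2 where \<delta>2: "\<delta>2 > 0" "\<And>x y. \<lbrakk>0 < x; x < \<delta>2; 0 < y; y < \<delta>2\<rbrakk> \<Longrightarrow>
      \<bar>partial i (partial j h) (p + x *\<^sub>R axis j 1 + y *\<^sub>R axis i 1) - partial i (partial j h) p\<bar> < \<epsilon> / 2"
      using near[OF half_gt_zero[OF \<epsilon>], of i j] by blast
    define s where "s = min (min \<delta>1 \<delta>2) e / 3"
    have s: "0 < s" "2 * s < e" "s < \<delta>1" "s < \<delta>2" using e \<delta>1 \<delta>2 by (auto simp: s_def)
    obtain \<sigma> \<tau> where 1: "0 < \<sigma>" "\<sigma> < s" "0 < \<tau>" "\<tau> < s"
      "h (p + s *\<^sub>R axis i 1 + s *\<^sub>R axis j 1) - h (p + s *\<^sub>R axis i 1) - h (p + s *\<^sub>R axis j 1) + h p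
        = s * (s * partial j (partial i h) (p + \<sigma> *\<^sub>R axis i 1 + \<tau> *\<^sub>R axis j 1))"
      by (rule second_difference_mean_value[OF assms(3) e(2) s(1,2)])
    obtain \<sigma>' \<tau>' where 2: "0 < \<sigma>'" "\<sigma>' < s" "0 < \<tau>'" "\<tau>' < s"
      "h (p + s *\<^sub>R axis j 1 + s *\<^sub>R axis i 1) - h (p + s *\<^sub>R axis j 1) - h (p + s *\<^sub>R axis i 1) + h p
        = s * (s * partial i (partial j h) (p + \<sigma>' *\<^sub>R axis j 1 + \<tau>' *\<^sub>R axis i 1))"
      by (rule second_difference_mean_value[OF assms(3) e(2) s(1,2)])
    have "s * (s * partial j (partial i h) (p + \<sigma> *\<^sub>R axis i 1 + \<tau> *\<^sub>R axis j 1)) =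
      s * (s * partial i (partial j h) (p + \<sigma>' *\<^sub>R axis j 1 + \<tau>' *\<^sub>R axis i 1))"
      unfolding 1(5)[symmetric] 2(5)[symmetric] by (simp add: add_ac)
    then have "partial j (partial i h) (p + \<sigma> *\<^sub>R axis i 1 + \<tau> *\<^sub>R axis j 1) =
      partial i (partial j h) (p + \<sigma>' *\<^sub>R axis j 1 + \<tau>' *\<^sub>R axis i 1)" using s by simp
    with \<delta>1(2)[of \<sigma> \<tau>] \<delta>2(2)[of \<sigma>' \<tau>'] 1(1-4) 2(1-4) s show ?thesis by linarith
  qed
  then have "\<bar>partial j (partial i h) p - partial i (partial j h) p\<bar> \<le> 0"
    by - (rule field_le_epsilon, simp)
  then show ?thesis by simp
qed

section \<open>Warped block form of the metric and its connection\<close>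

lemma vector_4 [simp]:
  "(vector [w, x, y, z] :: 'a::zero^4) $ 1 = w" "(vector [w, x, y, z] :: 'a^4) $ 2 = x"
  "(vector [w, x, y, z] :: 'a^4) $ 3 = y" "(vector [w, x, y, z] :: 'a^4) $ 4 = z"
  unfolding vector_def by simp_all

text \<open>
  Both \<open>\<gamma>\<close> and \<open>\<sigma>\<close> have this shape, and so have the metric and its derivatives.
\<close>

definition block :: "real \<Rightarrow> real \<Rightarrow> real \<Rightarrow> real^4^4" where
  "block x y z = vector [vector [x, y, 0, 0], vector [y, 0, 0, 0], vector [0, 0, z, 0], vector [0, 0, 0, z]]"

lemma block_nth [simp]:
  "block x y z $ 1 = vector [x, y, 0, 0]" "block x y z $ 2 = vector [y, 0, 0, 0]"
  "block x y z $ 3 = vector [0, 0, z, 0]" "block x y z $ 4 = vector [0, 0, 0, z]"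
  by (simp_all add: block_def)

lemma block_sym: "block x y z $ i $ j = block x y z $ j $ i"
  using exhaust_4[of i] exhaust_4[of j] by (elim disjE) simp_all

text \<open>
  All \<open>\<Gamma>\<^sup>k\<^sub>i\<^sub>j\<close> as the entry \<open>$ k $ i $ j\<close>, in terms of the eight functions that occur
  among them up to sign. The table is linear in these, so its derivative is the table of their
  derivatives.
\<close>

definition christoffel_table :: "real \<Rightarrow> real \<Rightarrow> real \<Rightarrow> real \<Rightarrow> real \<Rightarrow> real \<Rightarrow> real \<Rightarrow> real \<Rightarrow> real^4^4^4" where
  "christoffel_table c1 c2 c3 c4 c5 c6 c7 c8 = vector [
     vector [vector [c1, 0, 0, 0], vector [0, 0, 0, 0], vector [0, 0, c2, 0], vector [0, 0, 0, c2]],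
     vector [vector [c3, c4, 0, 0], vector [c4, 0, 0, 0], vector [0, 0, c5, 0], vector [0, 0, 0, c5]],
     vector [vector [0, 0, 0, 0], vector [0, 0, c6, 0], vector [0, c6, - c7, - c8], vector [0, 0, - c8, c7]],
     vector [vector [0, 0, 0, 0], vector [0, 0, 0, c6], vector [0, 0, c8, - c7], vector [0, c6, - c7, - c8]]]"

lemma christoffel_table_nth [simp]:
  "christoffel_table c1 c2 c3 c4 c5 c6 c7 c8 $ 1 =
     vector [vector [c1, 0, 0, 0], vector [0, 0, 0, 0], vector [0, 0, c2, 0], vector [0, 0, 0, c2]]"
  "christoffel_table c1 c2 c3 c4 c5 c6 c7 c8 $ 2 =
     vector [vector [c3, c4, 0, 0], vector [c4, 0, 0, 0], vector [0, 0, c5, 0], vector [0, 0, 0, c5]]"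
  "christoffel_table c1 c2 c3 c4 c5 c6 c7 c8 $ 3 =
     vector [vector [0, 0, 0, 0], vector [0, 0, c6, 0], vector [0, c6, - c7, - c8], vector [0, 0, - c8, c7]]"
  "christoffel_table c1 c2 c3 c4 c5 c6 c7 c8 $ 4 =
     vector [vector [0, 0, 0, 0], vector [0, 0, 0, c6], vector [0, 0, c8, - c7], vector [0, c6, - c7, - c8]]"
  by (simp_all add: christoffel_table_def)

lemma has_partial_block:
  assumes "has_partial m x x' p" "has_partial m y y' p" "has_partial m z z' p"
  shows "has_partial m (\<lambda>q. block (x q) (y q) (z q) $ i $ j) (block x' y' z' $ i $ j) p"
  using exhaust_4[of i] exhaust_4[of j] assms
  by (auto simp: block_def has_partial_const)

lemma has_partial_christoffel_table:
  assumes "has_partial m c1 d1 p" "has_partial m c2 d2 p" "has_partial m c3 d3 p" "has_partial m c4 d4 p"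
    "has_partial m c5 d5 p" "has_partial m c6 d6 p" "has_partial m c7 d7 p" "has_partial m c8 d8 p"
  shows "has_partial m (\<lambda>q. christoffel_table (c1 q) (c2 q) (c3 q) (c4 q) (c5 q) (c6 q) (c7 q) (c8 q) $ k $ i $ j)
           (christoffel_table d1 d2 d3 d4 d5 d6 d7 d8 $ k $ i $ j) p"
  using exhaust_4[of k] exhaust_4[of i] exhaust_4[of j] assms
  by (elim disjE) (simp_all add: christoffel_table_def has_partial_const has_partial_minus)

lemma matrix_inv_unique:
  fixes A B :: "real^'n::finite^'n"
  assumes "A ** B = mat 1" "B ** A = mat 1"
  shows "matrix_inv A = B"
proof -
  have "A ** matrix_inv A = mat 1"
    unfolding matrix_inv_def by (rule someI2[of _ B]) (use assms in auto)
  then show ?thesis by (metis assms(2) matrix_mul_assoc matrix_mul_lid matrix_mul_rid)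
qed

lemma matrix_inv_block:
  assumes "z \<noteq> 0"
  shows "matrix_inv (block x 1 z) = vector [vector [0, 1, 0, 0], vector [1, - x, 0, 0], vector [0, 0, 1 / z, 0], vector [0, 0, 0, 1 / z]]"
  using assms
  by (intro matrix_inv_unique)
     (simp_all add: block_def matrix_matrix_mult_def mat_def vec_eq_iff forall_4 sum_4)

definition RT_gtt :: "real \<Rightarrow> real \<Rightarrow> real \<Rightarrow> real \<Rightarrow> real" where
  "RT_gtt a b d r = - 2 * (a - 2 * b * r - d / r)"

definition RT_gtt' :: "real \<Rightarrow> real \<Rightarrow> real \<Rightarrow> real" where
  "RT_gtt' b d r = 4 * b - 2 * d / r\<^sup>2"

definition RT_gtt'' :: "real \<Rightarrow> real \<Rightarrow> real" where
  "RT_gtt'' d r = 4 * d / r ^ 3"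

lemma RT_metric_block:
  "RT_metric a b d f p = block (RT_gtt a b d (p $ 2)) 1 (- ((p $ 2)\<^sup>2 / (f (xy p))\<^sup>2))"
  by (simp add: RT_metric_def block_def RT_gtt_def Let_def)

definition RT_gamma :: "real \<Rightarrow> real \<Rightarrow> real \<Rightarrow> real^4 \<Rightarrow> real^4^4" where
  "RT_gamma a b d p = block (RT_gtt a b d (p $ 2)) 1 0"

definition RT_sigma :: "(real^2 \<Rightarrow> real) \<Rightarrow> real^4 \<Rightarrow> real^4^4" where
  "RT_sigma f p = block 0 0 (1 / (f (xy p))\<^sup>2)"

lemma RT_metric_split:
  "RT_metric a b d f p $ i $ j = RT_gamma a b d p $ i $ j - (p $ 2)\<^sup>2 * RT_sigma f p $ i $ j"
  using exhaust_4[of i] exhaust_4[of j]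
  by (elim disjE) (simp_all add: RT_metric_block RT_gamma_def RT_sigma_def)

text \<open>
  The connection coefficients at a point, with \<open>A\<close>, \<open>A1\<close> the values of \<open>g\<^sub>1\<^sub>1\<close> and its
  derivative, and \<open>u\<close>, \<open>ux\<close>, \<open>uy\<close> those of \<open>f\<close>.
\<close>

definition RT_christoffel :: "real \<Rightarrow> real \<Rightarrow> real \<Rightarrow> real \<Rightarrow> real \<Rightarrow> real \<Rightarrow> real^4^4^4" where
  "RT_christoffel A A1 r u ux uy =
     christoffel_table (- A1 / 2) (r / u\<^sup>2) (A * A1 / 2) (A1 / 2) (- (A * r / u\<^sup>2)) (1 / r) (ux / u) (uy / u)"

text \<open>
  Partial derivative of \<open>RT_christoffel\<close> in the direction \<open>m\<close>. Here \<open>dr\<close>, \<open>dx\<close>, \<open>dy\<close> are the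
  components of the \<open>m\<close>-th unit vector and \<open>du\<close> is the chain rule for \<open>f\<close>, so that one formula
  covers all four directions.
\<close>

definition RT_christoffel_diff ::
    "real \<Rightarrow> real \<Rightarrow> real \<Rightarrow> real \<Rightarrow> real \<Rightarrow> real \<Rightarrow> real \<Rightarrow> real \<Rightarrow> real \<Rightarrow> real \<Rightarrow> 4 \<Rightarrow> real^4^4^4" where
  "RT_christoffel_diff A A1 A2 r u ux uy uxx uxy uyy m =
     (let dr = axis m 1 $ 2; dx = axis m 1 $ 3; dy = axis m 1 $ 4; du = dx * ux + dy * uy in
      christoffel_table (- (dr * A2) / 2) (dr / u\<^sup>2 - 2 * r * du / u ^ 3)
        (dr * (A1\<^sup>2 + A * A2) / 2) (dr * A2 / 2)
        (2 * A * r * du / u ^ 3 - dr * (A1 * r + A) / u\<^sup>2) (- (dr / r\<^sup>2))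
        ((dx * uxx + dy * uxy) / u - ux * du / u\<^sup>2)
        ((dx * uxy + dy * uyy) / u - uy * du / u\<^sup>2))"

text \<open>
  The pointwise algebraic content of the curvature formula, valid for any \<open>g\<^sub>1\<^sub>1\<close>: the values
  \<open>A\<close>, \<open>A1\<close>, \<open>A2\<close> need not be related. It is checked component by component.
\<close>

lemma riemann_components:
  fixes r u ux uy uxx uxy uyy A A1 A2 :: real
  assumes "r \<noteq> 0" "u \<noteq> 0"
  defines "T \<equiv> RT_christoffel A A1 r u ux uy" and "D \<equiv> RT_christoffel_diff A A1 A2 r u ux uy uxx uxy uyy"
    and "\<gamma> \<equiv> \<lambda>_::real^4. block A 1 0" and "\<sigma> \<equiv> \<lambda>_::real^4. block 0 0 (1 / u\<^sup>2)"
  shows "(\<Sum>\<alpha>\<in>UNIV. block A 1 (- (r\<^sup>2 / u\<^sup>2)) $ i $ \<alpha> *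
        (D k $ \<alpha> $ j $ l - D l $ \<alpha> $ j $ k
          + (\<Sum>\<beta>\<in>UNIV. T $ \<beta> $ j $ l * T $ \<alpha> $ \<beta> $ k - T $ \<beta> $ j $ k * T $ \<alpha> $ \<beta> $ l))) =
    - (A2 / 4) * kulkarni_nomizu \<gamma> \<gamma> x i j k l + (r * A1 / 2) * kulkarni_nomizu \<gamma> \<sigma> x i j k l
    - (r\<^sup>2 * (ux\<^sup>2 + uy\<^sup>2 - u * (uxx + uyy) + A) / 2) * kulkarni_nomizu \<sigma> \<sigma> x i j k l"
    (is "?P i j k l")
proof -
  \<comment> \<open>The entries are named before the sums are expanded: almost all of the resulting products
    contain a zero factor, and they disappear before any field arithmetic is done.\<close>
  define c1 c2 c3 c4 c5 c6 c7 c8 h w where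
    c: "c1 = - A1 / 2" "c2 = r / u\<^sup>2" "c3 = A * A1 / 2" "c4 = A1 / 2" "c5 = - (A * r / u\<^sup>2)"
    "c6 = 1 / r" "c7 = ux / u" "c8 = uy / u" "h = - (r\<^sup>2 / u\<^sup>2)" "w = 1 / u\<^sup>2"
  define d1 d2 d3 d4 d5 d6 d7 d8 where
   d: "d1 = (\<lambda>m::4. - (axis m 1 $ 2 * A2) / 2)"
    "d2 = (\<lambda>m::4. axis m 1 $ 2 / u\<^sup>2 - 2 * r * (axis m 1 $ 3 * ux + axis m 1 $ 4 * uy) / u ^ 3)"
    "d3 = (\<lambda>m::4. axis m 1 $ 2 * (A1\<^sup>2 + A * A2) / 2)"
    "d4 = (\<lambda>m::4. axis m 1 $ 2 * A2 / 2)"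
    "d5 = (\<lambda>m::4. 2 * A * r * (axis m 1 $ 3 * ux + axis m 1 $ 4 * uy) / u ^ 3 - axis m 1 $ 2 * (A1 * r + A) / u\<^sup>2)"
    "d6 = (\<lambda>m::4. - (axis m 1 $ 2 / r\<^sup>2))"
    "d7 = (\<lambda>m::4. (axis m 1 $ 3 * uxx + axis m 1 $ 4 * uxy) / u - ux * (axis m 1 $ 3 * ux + axis m 1 $ 4 * uy) / u\<^sup>2)"
    "d8 = (\<lambda>m::4. (axis m 1 $ 3 * uxy + axis m 1 $ 4 * uyy) / u - uy * (axis m 1 $ 3 * ux + axis m 1 $ 4 * uy) / u\<^sup>2)"
  have T: "T = christoffel_table c1 c2 c3 c4 c5 c6 c7 c8" by (simp add: T_def RT_christoffel_def c)
  have D: "D m = christoffel_table (d1 m) (d2 m) (d3 m) (d4 m) (d5 m) (d6 m) (d7 m) (d8 m)" for m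
    by (simp add: D_def RT_christoffel_diff_def Let_def d)
  have "\<forall>i j k l. ?P i j k l"
    unfolding T D \<gamma>_def \<sigma>_def kulkarni_nomizu_def c(9,10)[symmetric] sum_4
    unfolding forall_4
    by (intro conjI)
       (simp_all only: christoffel_table_nth block_nth vector_4 mult_zero_left mult_zero_right add_0_left add_0_right
          diff_zero diff_0 minus_zero diff_self,
        simp_all only: c d axis_def vec_lambda_beta,
        simp_all add: assms(1,2),
        simp_all add: assms(1,2) field_simps power2_eq_square power3_eq_cube power4_eq_xxxx)
  then show ?thesis by blast
qed

section \<open>Kulkarni--Nomizu products and Lie derivatives\<close>

text \<open>
  Bilinearity and symmetry of the Kulkarni--Nomizu product. It places \<open>g \<and> g\<close> and \<open>g \<and> S\<close> in
  the span of \<open>\<gamma> \<and> \<gamma>\<close>, \<open>\<gamma> \<and> \<sigma>\<close>, \<open>\<sigma> \<and> \<sigma>\<close>.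
\<close>

lemma kulkarni_nomizu_combination:
  assumes g: "\<And>i j. g x $ i $ j = \<gamma> x $ i $ j + s * \<sigma> x $ i $ j"
    and S: "\<And>i j. S x $ i $ j = c * \<gamma> x $ i $ j + t * \<sigma> x $ i $ j"
    and sym: "\<And>i j. \<gamma> x $ i $ j = \<gamma> x $ j $ i" "\<And>i j. \<sigma> x $ i $ j = \<sigma> x $ j $ i"
  shows "kulkarni_nomizu g S x i j k l = c * kulkarni_nomizu \<gamma> \<gamma> x i j k l
    + (t + s * c) * kulkarni_nomizu \<gamma> \<sigma> x i j k l + s * t * kulkarni_nomizu \<sigma> \<sigma> x i j k l"
  unfolding kulkarni_nomizu_def g S by (simp add: algebra_simps)

text \<open>
  The components of a coordinate vector field are constant, so only the transport term remains.
\<close>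

lemma lie_derivative_axis:
  "lie_derivative (\<lambda>_. axis m 1) T x i j k l = partial m (\<lambda>y. T y i j k l) x"
proof -
  have "partial n (\<lambda>_. c) x = 0" for n and c :: real
    by (rule has_partial_imp_partial[OF has_partial_const])
  moreover have "(\<Sum>n\<in>UNIV. axis m 1 $ n * partial n (\<lambda>y. T y i j k l) x) =
      (\<Sum>n\<in>UNIV. if n = m then partial n (\<lambda>y. T y i j k l) x else 0)"
    by (intro sum.cong) (auto simp: axis_def)
  ultimately show ?thesis by (simp add: lie_derivative_def)
qed

text \<open>
  Leibniz rule for tensors that a derivation rescales: the factors add up.
\<close>

lemma has_partial_kulkarni_nomizu:
  assumes \<phi>: "\<And>i j. has_partial m (\<lambda>q. \<phi> q $ i $ j) (s * \<phi> p $ i $ j) p"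
    and \<psi>: "\<And>i j. has_partial m (\<lambda>q. \<psi> q $ i $ j) (t * \<psi> p $ i $ j) p"
  shows "has_partial m (\<lambda>q. kulkarni_nomizu \<phi> \<psi> q i j k l) ((s + t) * kulkarni_nomizu \<phi> \<psi> p i j k l) p"
  unfolding kulkarni_nomizu_def
  by (rule has_partial_eq_rhs, (rule has_partial_intros \<phi> \<psi>)+) (simp add: algebra_simps)

section \<open>Functions of the last two coordinates\<close>

lemma has_partial_xy:
  assumes "has_partial 1 h (hx (xy p)) (xy p)" "has_partial 2 h (hy (xy p)) (xy p)"
  shows "has_partial m (\<lambda>q. h (xy q)) (axis m 1 $ 3 * hx (xy p) + axis m 1 $ 4 * hy (xy p)) p"
proof -
  have "xy (p + s *\<^sub>R axis 1 1) = xy p" "xy (p + s *\<^sub>R axis 2 1) = xy p"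
    "xy (p + s *\<^sub>R axis 3 1) = xy p + s *\<^sub>R axis 1 1" "xy (p + s *\<^sub>R axis 4 1) = xy p + s *\<^sub>R axis 2 1" for s
    by (simp_all add: xy_def vec_eq_iff forall_2 axis_def)
  then show ?thesis using exhaust_4[of m] assms
    by (auto simp: has_partial_def axis_def)
qed

lemma continuous_on_xy: "continuous_on S xy"
proof -
  have xy: "xy = (\<lambda>p. p $ 3 *\<^sub>R axis 1 1 + p $ 4 *\<^sub>R axis 2 1)"
    by (auto simp: xy_def vec_eq_iff forall_2 axis_def fun_eq_iff)
  show ?thesis unfolding xy by (intro continuous_intros)
qed

lemma open_RT_domain:
  assumes "open I" "open J" "open \<Omega>"
  shows "open (RT_domain I J \<Omega>)"
proof -
  have "RT_domain I J \<Omega> = (\<lambda>p. p $ 1) -` I \<inter> (\<lambda>p. p $ 2) -` J \<inter> xy -` \<Omega>"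
    by (auto simp: RT_domain_def)
  then show ?thesis
    using assms by (auto intro!: open_Int open_vimage continuous_on_xy continuous_on_component continuous_on_id)
qed

text \<open>
  A partial derivative of \<open>h (xy p)\<close> is again of this form, or zero in the directions \<open>t\<close> and \<open>r\<close>.
\<close>

lemma smooth_on_xy:
  assumes "open U" "smooth_on \<Omega> h" "\<And>p. p \<in> U \<Longrightarrow> xy p \<in> \<Omega>"
  shows "smooth_on U (\<lambda>p. h (xy p))"
proof (rule smooth_on_coinduct[where P = "\<lambda>k. (\<exists>h. smooth_on \<Omega> h \<and> k = (\<lambda>p. h (xy p))) \<or> k = (\<lambda>_. 0)"])
  fix k :: "real^4 \<Rightarrow> real"
  assume "(\<exists>h. smooth_on \<Omega> h \<and> k = (\<lambda>p. h (xy p))) \<or> k = (\<lambda>_. 0)"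
  then show "continuous_on U k \<and> (\<forall>m. \<exists>k'. ((\<exists>h. smooth_on \<Omega> h \<and> k' = (\<lambda>p. h (xy p))) \<or> k' = (\<lambda>_. 0))
      \<and> (\<forall>p\<in>U. has_partial m k (k' p) p))"
  proof
    assume "\<exists>h. smooth_on \<Omega> h \<and> k = (\<lambda>p. h (xy p))"
    then obtain h where h: "smooth_on \<Omega> h" and k: "k = (\<lambda>p. h (xy p))" by blast
    have "continuous_on U k" unfolding k
      by (rule continuous_on_compose2[OF smooth_on_imp_continuous_on[OF h] continuous_on_xy])
         (use assms in auto)
    moreover have "\<exists>k'. ((\<exists>h. smooth_on \<Omega> h \<and> k' = (\<lambda>p. h (xy p))) \<or> k' = (\<lambda>_. 0))
      \<and> (\<forall>p\<in>U. has_partial m k (k' p) p)" for m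
    proof -
      have D: "has_partial m k (axis m 1 $ 3 * partial 1 h (xy p) + axis m 1 $ 4 * partial 2 h (xy p)) p"
        if "p \<in> U" for p
        unfolding k using that assms by (intro has_partial_xy smooth_on_has_partial[OF h]) auto
      consider "m = 1 \<or> m = 2" | "m = 3" | "m = 4" using exhaust_4[of m] by blast
      then show ?thesis
      proof cases
        case 1
        then show ?thesis using D by (intro exI[of _ "\<lambda>_. 0"]) (auto simp: axis_def)
      next
        case 2
        then show ?thesis using D smooth_on_partial[OF h]
          by (intro exI[of _ "\<lambda>p. partial 1 h (xy p)"]) (auto simp: axis_def)
      next
        case 3
        then show ?thesis using D smooth_on_partial[OF h]
          by (intro exI[of _ "\<lambda>p. partial 2 h (xy p)"]) (auto simp: axis_def)
      qed
    qed
    ultimately show ?thesis by blast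
  next
    assume "k = (\<lambda>_. 0)"
    then show ?thesis by (auto intro!: exI[of _ "\<lambda>_. 0"] has_partial_const)
  qed
qed (use assms in auto)

section \<open>Curvature of the Robinson--Trautman metric\<close>

locale robinson_trautman =
  fixes a b d :: real and I J :: "real set" and \<Omega> :: "(real^2) set" and f :: "real^2 \<Rightarrow> real"
  assumes open_I: "open I" and open_J: "open J" and J_nonzero: "0 \<notin> J"
    and open_\<Omega>: "open \<Omega>" and smooth_f: "smooth_on \<Omega> f" and f_nonzero: "\<And>z. z \<in> \<Omega> \<Longrightarrow> f z \<noteq> 0"
begin

abbreviation M :: "(real^4) set" where "M \<equiv> RT_domain I J \<Omega>"
abbreviation g :: "real^4 \<Rightarrow> real^4^4" where "g \<equiv> RT_metric a b d f"
abbreviation \<gamma> :: "real^4 \<Rightarrow> real^4^4" where "\<gamma> \<equiv> RT_gamma a b d"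
abbreviation \<sigma> :: "real^4 \<Rightarrow> real^4^4" where "\<sigma> \<equiv> RT_sigma f"
abbreviation A :: "real \<Rightarrow> real" where "A \<equiv> RT_gtt a b d"
abbreviation A' :: "real \<Rightarrow> real" where "A' \<equiv> RT_gtt' b d"
abbreviation A'' :: "real \<Rightarrow> real" where "A'' \<equiv> RT_gtt'' d"

lemma open_M: "open M"
  by (intro open_RT_domain open_I open_J open_\<Omega>)

lemma M_D: "p \<in> M \<Longrightarrow> p $ 2 \<noteq> 0" "p \<in> M \<Longrightarrow> xy p \<in> \<Omega>" "p \<in> M \<Longrightarrow> f (xy p) \<noteq> 0"
  using J_nonzero f_nonzero by (auto simp: RT_domain_def)

lemma has_partial_smooth_xy:
  assumes "smooth_on \<Omega> h" "p \<in> M"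
  shows "has_partial m (\<lambda>q. h (xy q)) (axis m 1 $ 3 * partial 1 h (xy p) + axis m 1 $ 4 * partial 2 h (xy p)) p"
  by (intro has_partial_xy smooth_on_has_partial[OF assms(1)] M_D assms)

lemma partial_commute_f: "z \<in> \<Omega> \<Longrightarrow> partial 1 (partial 2 f) z = partial 2 (partial 1 f) z"
  by (rule partial_commute[OF open_\<Omega> _ smooth_f])

lemma has_partial_gtt:
  assumes "p \<in> M"
  shows "has_partial m (\<lambda>q. A (q $ 2)) (axis m 1 $ 2 * A' (p $ 2)) p"
  unfolding RT_gtt_def RT_gtt'_def
  by (rule has_partial_eq_rhs, (rule has_partial_intros M_D assms)+)
     (use M_D[OF assms] in \<open>simp add: field_simps power2_eq_square\<close>)

lemma has_partial_gtt':
  assumes "p \<in> M"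
  shows "has_partial m (\<lambda>q. A' (q $ 2)) (axis m 1 $ 2 * A'' (p $ 2)) p"
  unfolding RT_gtt''_def RT_gtt'_def
  by (rule has_partial_eq_rhs, (rule has_partial_intros power_not_zero M_D assms)+)
     (use M_D[OF assms] in \<open>simp add: field_simps power2_eq_square power3_eq_cube\<close>)

lemma has_partial_metric:
  assumes "p \<in> M"
  shows "has_partial m (\<lambda>q. g q $ i $ j)
    (block (axis m 1 $ 2 * A' (p $ 2)) 0
      (2 * (p $ 2)\<^sup>2 * (axis m 1 $ 3 * partial 1 f (xy p) + axis m 1 $ 4 * partial 2 f (xy p)) / f (xy p) ^ 3
        - 2 * (p $ 2) * axis m 1 $ 2 / (f (xy p))\<^sup>2) $ i $ j) p"
  unfolding RT_metric_block
proof (rule has_partial_block[OF has_partial_gtt[OF assms] has_partial_const])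
  show "has_partial m (\<lambda>q. - ((q $ 2)\<^sup>2 / (f (xy q))\<^sup>2))
    (2 * (p $ 2)\<^sup>2 * (axis m 1 $ 3 * partial 1 f (xy p) + axis m 1 $ 4 * partial 2 f (xy p)) / f (xy p) ^ 3
        - 2 * (p $ 2) * axis m 1 $ 2 / (f (xy p))\<^sup>2) p"
    by (rule has_partial_eq_rhs, (rule has_partial_intros has_partial_smooth_xy smooth_f power_not_zero M_D assms)+)
       (use M_D[OF assms] in \<open>simp add: field_simps power2_eq_square power3_eq_cube\<close>)
qed

lemma christoffel_RT:
  assumes "p \<in> M"
  defines "r \<equiv> p $ 2" and "u \<equiv> f (xy p)"
  shows "christoffel g k i j p =
    RT_christoffel (A r) (A' r) r u (partial 1 f (xy p)) (partial 2 f (xy p)) $ k $ i $ j" (is "?P k i j")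
proof -
  have ne: "r \<noteq> 0" "u \<noteq> 0" using M_D[OF assms(1)] by (auto simp: r_def u_def)
  have inv: "matrix_inv (g p) = vector [vector [0, 1, 0, 0], vector [1, - A r, 0, 0],
      vector [0, 0, - u\<^sup>2 / r\<^sup>2, 0], vector [0, 0, 0, - u\<^sup>2 / r\<^sup>2]]"
    using ne by (simp add: RT_metric_block matrix_inv_block r_def[symmetric] u_def[symmetric])
  note [simp] = has_partial_imp_partial[OF has_partial_metric[OF assms(1)], folded r_def u_def]
  have "\<forall>k i j. ?P k i j"
    unfolding christoffel_def RT_christoffel_def inv sum_4 forall_4
    by (simp add: ne axis_def) (simp add: ne field_simps power2_eq_square power3_eq_cube)
  then show ?thesis by blast
qed

lemma has_partial_christoffel:
  assumes "p \<in> M"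
  shows "has_partial m (christoffel g k i j)
    (RT_christoffel_diff (A (p $ 2)) (A' (p $ 2)) (A'' (p $ 2)) (p $ 2) (f (xy p))
      (partial 1 f (xy p)) (partial 2 f (xy p)) (partial 1 (partial 1 f) (xy p))
      (partial 2 (partial 1 f) (xy p)) (partial 2 (partial 2 f) (xy p)) m $ k $ i $ j) p"
proof -
  note f = has_partial_smooth_xy[OF smooth_f assms]
    has_partial_smooth_xy[OF smooth_on_partial[OF smooth_f] assms]
  have "has_partial m (\<lambda>p. RT_christoffel (A (p $ 2)) (A' (p $ 2)) (p $ 2) (f (xy p))
      (partial 1 f (xy p)) (partial 2 f (xy p)) $ k $ i $ j)
    (RT_christoffel_diff (A (p $ 2)) (A' (p $ 2)) (A'' (p $ 2)) (p $ 2) (f (xy p))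
      (partial 1 f (xy p)) (partial 2 f (xy p)) (partial 1 (partial 1 f) (xy p))
      (partial 2 (partial 1 f) (xy p)) (partial 2 (partial 2 f) (xy p)) m $ k $ i $ j) p"
    unfolding RT_christoffel_def RT_christoffel_diff_def Let_def
    by (rule has_partial_christoffel_table;
        rule has_partial_eq_rhs,
        (rule has_partial_intros has_partial_gtt has_partial_gtt' f power_not_zero numeral_neq_zero M_D assms)+,
        use M_D[OF assms] in \<open>simp add: partial_commute_f field_simps power2_eq_square power3_eq_cube\<close>)
  then show ?thesis
    using has_partial_cong[OF open_M assms christoffel_RT] by simp
qed

text \<open>
  \<open>\<gamma>\<close> and \<open>r\<^sup>2 \<sigma>\<close> are the two orthogonal blocks of a warped product whose factors have dimension
  two. Each product carries one kind of sectional curvature: \<open>\<gamma> \<and> \<gamma>\<close> that of the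
  \<open>(t, r)\<close> plane, \<open>\<gamma> \<and> \<sigma>\<close> that of the mixed planes, and \<open>\<sigma> \<and> \<sigma>\<close> that of the \<open>(x, y)\<close> plane.
  The last one involves \<open>F\<^sub>1\<close>, which is minus the Gaussian curvature of \<open>\<sigma>\<close>.
\<close>

lemma riemann_RT:
  assumes "p \<in> M"
  defines "r \<equiv> p $ 2"
  shows "riemann g p i j k l =
    - (A'' r / 4) * kulkarni_nomizu \<gamma> \<gamma> p i j k l + (r * A' r / 2) * kulkarni_nomizu \<gamma> \<sigma> p i j k l
    - (r\<^sup>2 * (RT_F1 f (xy p) + A r) / 2) * kulkarni_nomizu \<sigma> \<sigma> p i j k l"
proof -
  have "kulkarni_nomizu \<gamma> \<gamma> p = kulkarni_nomizu (\<lambda>_. block (A r) 1 0) (\<lambda>_. block (A r) 1 0) p"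
    "kulkarni_nomizu \<gamma> \<sigma> p = kulkarni_nomizu (\<lambda>_. block (A r) 1 0) (\<lambda>_. block 0 0 (1 / (f (xy p))\<^sup>2)) p"
    "kulkarni_nomizu \<sigma> \<sigma> p =
      kulkarni_nomizu (\<lambda>_. block 0 0 (1 / (f (xy p))\<^sup>2)) (\<lambda>_. block 0 0 (1 / (f (xy p))\<^sup>2)) p"
    unfolding kulkarni_nomizu_def RT_gamma_def RT_sigma_def r_def by auto
  moreover have "RT_F1 f (xy p) = (partial 1 f (xy p))\<^sup>2 + (partial 2 f (xy p))\<^sup>2
      - f (xy p) * (partial 1 (partial 1 f) (xy p) + partial 2 (partial 2 f) (xy p))"
    by (simp add: RT_F1_def Let_def)
  ultimately show ?thesis
    unfolding riemann_def RT_metric_block christoffel_RT[OF assms(1), unfolded RT_metric_block]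
      has_partial_imp_partial[OF has_partial_christoffel[OF assms(1)], unfolded RT_metric_block]
    using riemann_components[OF M_D(1,3)[OF assms(1)]] by (simp only: r_def)
qed

text \<open>
  Contraction of \<open>riemann_RT\<close>. The \<open>\<gamma>\<close> part is \<open>- (A''/2 + A'/r) \<gamma>\<close> and the \<open>\<sigma>\<close> part is
  \<open>(F\<^sub>1 + A + r A') \<sigma>\<close>; for the present \<open>A\<close> the terms in \<open>d\<close> cancel in both.
\<close>

lemma ricci_RT:
  assumes "p \<in> M"
  defines "r \<equiv> p $ 2"
  shows "ricci g p $ j $ k =
    - (4 * b / r) * \<gamma> p $ j $ k + (RT_F1 f (xy p) - 2 * a + 8 * b * r) * \<sigma> p $ j $ k" (is "?P j k")
proof -
  define u F where "u = f (xy p)" and "F = RT_F1 f (xy p)"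
  have ne: "r \<noteq> 0" "u \<noteq> 0" using M_D[OF assms(1)] by (auto simp: r_def u_def)
  \<comment> \<open>Opaque names keep the contraction polynomial in the values of \<open>A\<close> and its derivatives;
    their explicit form is needed in \<open>c\<close> only.\<close>
  define B B' B'' where B: "B = A r" "B' = A' r" "B'' = A'' r"
  have inv: "matrix_inv (g p) = vector [vector [0, 1, 0, 0], vector [1, - B, 0, 0],
      vector [0, 0, - u\<^sup>2 / r\<^sup>2, 0], vector [0, 0, 0, - u\<^sup>2 / r\<^sup>2]]"
    using ne by (simp add: RT_metric_block matrix_inv_block r_def[symmetric] u_def[symmetric] B)
  have val: "\<gamma> p = block B 1 0" "\<sigma> p = block 0 0 (1 / u\<^sup>2)"
    by (simp_all add: RT_gamma_def RT_sigma_def B u_def r_def)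
  have c: "- (4 * b / r) = - (B'' / 2 + B' / r)" "F - 2 * a + 8 * b * r = F + B + r * B'"
    using ne unfolding B RT_gtt_def RT_gtt'_def RT_gtt''_def
    by (simp_all add: field_simps power2_eq_square power3_eq_cube)
  have "\<forall>j k. ?P j k"
    unfolding ricci_def vec_lambda_beta inv riemann_RT[OF assms(1), folded r_def, folded B F_def] sum_4 forall_4
      kulkarni_nomizu_def val F_def[symmetric] c
    by (simp add: ne) (simp add: ne field_simps power2_eq_square power4_eq_xxxx)
  then show ?thesis by blast
qed

lemma has_partial_F1:
  assumes "z \<in> \<Omega>"
  shows "has_partial 1 (RT_F1 f)
    (2 * partial 1 f z * partial 1 (partial 1 f) z + 2 * partial 2 f z * partial 2 (partial 1 f) z
      - partial 1 f z * (partial 1 (partial 1 f) z + partial 2 (partial 2 f) z)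
      - f z * (partial 1 (partial 1 (partial 1 f)) z + partial 2 (partial 2 (partial 1 f)) z)) z"
proof -
  \<comment> \<open>Differentiating \<open>f\<^sub>y\<^sub>y\<close> leaves \<open>\<partial>\<^sub>x\<close> outermost, while \<open>F\<^sub>4\<close> is written with \<open>\<partial>\<^sub>x\<close> innermost.\<close>
  have "partial 1 (partial 2 (partial 2 f)) z = partial 2 (partial 1 (partial 2 f)) z"
    by (rule partial_commute[OF open_\<Omega> assms smooth_on_partial[OF smooth_f]])
  also have "\<dots> = partial 2 (partial 2 (partial 1 f)) z"
    by (rule partial_cong[OF open_\<Omega> assms partial_commute_f])
  finally have xyy: "partial 1 (partial 2 (partial 2 f)) z = partial 2 (partial 2 (partial 1 f)) z" .
  have "RT_F1 f = (\<lambda>z. (partial 1 f z)\<^sup>2 + (partial 2 f z)\<^sup>2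
      - f z * (partial 1 (partial 1 f) z + partial 2 (partial 2 f) z))"
    by (auto simp: RT_F1_def Let_def)
  then show ?thesis
    by (simp only:)
       (rule has_partial_eq_rhs, (rule has_partial_intros smooth_on_has_partial[OF _ assms] smooth_on_partial smooth_f)+,
        simp add: xyy partial_commute_f[OF assms] algebra_simps)
qed

text \<open>
  Neither \<open>\<gamma>\<close> nor the direction of \<open>\<sigma>\<close> changes along \<open>\<partial>/\<partial>x\<close>. The vanishing derivative of \<open>\<gamma>\<close> is
  written as a rescaling by \<open>0\<close>, to match \<open>has_partial_kulkarni_nomizu\<close>.
\<close>

lemma has_partial_gamma: "has_partial 3 (\<lambda>q. \<gamma> q $ i $ j) (0 * \<gamma> p $ i $ j) p" if "p \<in> M"
proof -
  have "block 0 0 0 $ i $ j = 0" using exhaust_4[of i] exhaust_4[of j] by (elim disjE) simp_all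
  then show ?thesis
    unfolding RT_gamma_def
    using has_partial_block[OF has_partial_gtt[OF that] has_partial_const has_partial_const, of 3 1 0 i j]
    by (simp add: axis_def)
qed

lemma has_partial_sigma:
  "has_partial 3 (\<lambda>q. \<sigma> q $ i $ j) (- 2 * partial 1 f (xy p) / f (xy p) * \<sigma> p $ i $ j) p" if "p \<in> M"
proof -
  have "has_partial 3 (\<lambda>q. 1 / (f (xy q))\<^sup>2) (- 2 * partial 1 f (xy p) / f (xy p) * (1 / (f (xy p))\<^sup>2)) p"
    by (rule has_partial_eq_rhs, (rule has_partial_intros has_partial_smooth_xy smooth_f power_not_zero M_D that)+)
       (use M_D[OF that] in \<open>simp add: axis_def field_simps power2_eq_square\<close>)
  from has_partial_block[OF has_partial_const has_partial_const this, of 0 0 i j]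
  show ?thesis unfolding RT_sigma_def
    using exhaust_4[of i] exhaust_4[of j] by (elim disjE) simp_all
qed

text \<open>
  Along \<open>\<partial>/\<partial>x\<close> the product \<open>\<gamma> \<and> \<gamma>\<close> and the coefficients depending on \<open>r\<close> alone are constant,
  while \<open>\<gamma> \<and> \<sigma>\<close> and \<open>\<sigma> \<and> \<sigma>\<close> are rescaled by \<open>- 2 f\<^sub>x / f\<close> and \<open>- 4 f\<^sub>x / f\<close>.
\<close>

lemma lie_derivative_riemann_RT:
  assumes "p \<in> M"
  defines "r \<equiv> p $ 2" and "u \<equiv> f (xy p)" and "ux \<equiv> partial 1 f (xy p)"
  shows "lie_derivative (\<lambda>_. axis 3 1) (riemann g) p i j k l =
    - (r * A' r * ux / u) * kulkarni_nomizu \<gamma> \<sigma> p i j k l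
    + (2 * r\<^sup>2 * (RT_F1 f (xy p) + A r) * ux / u - r\<^sup>2 * partial 1 (RT_F1 f) (xy p) / 2)
      * kulkarni_nomizu \<sigma> \<sigma> p i j k l"
proof -
  note kn = has_partial_kulkarni_nomizu[OF has_partial_gamma has_partial_gamma, OF assms(1) assms(1)]
    has_partial_kulkarni_nomizu[OF has_partial_gamma has_partial_sigma, OF assms(1) assms(1)]
    has_partial_kulkarni_nomizu[OF has_partial_sigma has_partial_sigma, OF assms(1) assms(1)]
  have F1: "has_partial 3 (\<lambda>q. RT_F1 f (xy q)) (partial 1 (RT_F1 f) (xy p)) p"
  proof -
    have "smooth_on \<Omega> (RT_F1 f)"
      unfolding RT_F1_def Let_def
      by (intro smooth_on_add smooth_on_diff smooth_on_mult smooth_on_power smooth_on_partial smooth_f open_\<Omega>)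
    from has_partial_smooth_xy[OF this assms(1), of 3] show ?thesis by (simp add: axis_def)
  qed
  note AA = has_partial_gtt[OF assms(1), of 3] has_partial_gtt'[OF assms(1), of 3]
  have A'': "has_partial 3 (\<lambda>q. A'' (q $ 2)) 0 p"
    unfolding RT_gtt''_def
    by (rule has_partial_eq_rhs, (rule has_partial_intros power_not_zero M_D assms(1))+) (simp add: axis_def)
  have "has_partial 3 (\<lambda>q. - (A'' (q $ 2) / 4) * kulkarni_nomizu \<gamma> \<gamma> q i j k l
      + (q $ 2 * A' (q $ 2) / 2) * kulkarni_nomizu \<gamma> \<sigma> q i j k l
      - ((q $ 2)\<^sup>2 * (RT_F1 f (xy q) + A (q $ 2)) / 2) * kulkarni_nomizu \<sigma> \<sigma> q i j k l)
    (- (r * A' r * ux / u) * kulkarni_nomizu \<gamma> \<sigma> p i j k l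
    + (2 * r\<^sup>2 * (RT_F1 f (xy p) + A r) * ux / u - r\<^sup>2 * partial 1 (RT_F1 f) (xy p) / 2)
      * kulkarni_nomizu \<sigma> \<sigma> p i j k l) p"
    by (rule has_partial_eq_rhs, (rule kn F1 AA A'' has_partial_intros numeral_neq_zero)+)
       (use M_D[OF assms(1)] in \<open>simp add: axis_def r_def u_def ux_def field_simps power2_eq_square\<close>)
  then have "has_partial 3 (\<lambda>q. riemann g q i j k l)
    (- (r * A' r * ux / u) * kulkarni_nomizu \<gamma> \<sigma> p i j k l
    + (2 * r\<^sup>2 * (RT_F1 f (xy p) + A r) * ux / u - r\<^sup>2 * partial 1 (RT_F1 f) (xy p) / 2)
      * kulkarni_nomizu \<sigma> \<sigma> p i j k l) p"
    using has_partial_cong[OF open_M assms(1) riemann_RT] by simp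
  then show ?thesis
    unfolding lie_derivative_axis by (rule has_partial_imp_partial)
qed

text \<open>
  This form shows what \<open>F\<^sub>4\<close> stands for: up to a factor it is the inhomogeneous term left over
  when \<open>\<lambda>\<^sub>1\<close> and \<open>\<lambda>\<^sub>2\<close> are eliminated from the three scalar equations.
\<close>

lemma F4_eq:
  assumes "z \<in> \<Omega>"
  shows "RT_F4 a b d f r z = r * f z * partial 1 (RT_F1 f) z - 4 * r * partial 1 f z * RT_F1 f z
    + (- 12 * d + 8 * a * r - 8 * b * r\<^sup>2) * partial 1 f z"
  unfolding has_partial_imp_partial[OF has_partial_F1[OF assms]] RT_F4_def RT_F1_def Let_def
  by (simp add: algebra_simps power2_eq_square power3_eq_cube)

end

section \<open>Solution of the scalar equations\<close>

text \<open>
  The coefficients of \<open>\<gamma> \<and> \<gamma>\<close>, \<open>\<gamma> \<and> \<sigma>\<close> and \<open>\<sigma> \<and> \<sigma>\<close> in the inheritance equation, where \<open>F\<close>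
  and \<open>F'\<close> stand for \<open>F\<^sub>1\<close> and \<open>\<partial>\<^sub>x F\<^sub>1\<close>. The first equation gives \<open>\<lambda>\<^sub>1\<close>. Substituted in
  the second one it gives \<open>P \<lambda>\<^sub>2\<close> with \<open>P = F - 2a + 4br\<close>. The third one then determines
  \<open>\<lambda>\<close>, with coefficient \<open>rE/2\<close> for \<open>E = 2ar - 6d - rF\<close>. The proof checks that the
  closed forms satisfy these triangular relations, which avoids clearing all denominators at once.
\<close>

lemma inheritance_coefficients:
  fixes a b d r u ux F F' :: real
  assumes r: "r \<noteq> 0" and u: "u \<noteq> 0"
    and P: "F - 2 * a + 4 * b * r \<noteq> 0" and E: "- 6 * d + 2 * a * r - r * F \<noteq> 0"
  defines "F4 \<equiv> r * u * F' - 4 * r * ux * F + (- 12 * d + 8 * a * r - 8 * b * r\<^sup>2) * ux"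
  defines "lam \<equiv> - (F4 / (u * (- 6 * d + 2 * a * r - r * F)))"
    and "lam1 \<equiv> - (8 * b * (- d + 2 * b * r\<^sup>2) * ux / (r\<^sup>2 * u * (F - 2 * a + 4 * b * r)))
      + (2 * a * d - 16 * b * d * r + 8 * b\<^sup>2 * r ^ 3 - d * F) * F4
        / (r ^ 3 * u * (F - 2 * a + 4 * b * r) * (- 6 * d + 2 * a * r - r * F))"
    and "lam2 \<equiv> - (2 * (- d + 2 * b * r\<^sup>2) * ux / (r * u * (F - 2 * a + 4 * b * r)))
      + (- 3 * d + 2 * b * r\<^sup>2) * F4
        / (r * u * (F - 2 * a + 4 * b * r) * (- 6 * d + 2 * a * r - r * F))"
  shows "0 = - (RT_gtt'' d r / 4) * lam + lam1 - (4 * b / r) * lam2"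
    and "- (r * RT_gtt' b d r * ux / u) = (r * RT_gtt' b d r / 2) * lam - 2 * r\<^sup>2 * lam1
      + (F - 2 * a + 12 * b * r) * lam2"
    and "2 * r\<^sup>2 * (F + RT_gtt a b d r) * ux / u - r\<^sup>2 * F' / 2 =
      - (r\<^sup>2 * (F + RT_gtt a b d r) / 2) * lam + r ^ 4 * lam1 - r\<^sup>2 * (F - 2 * a + 8 * b * r) * lam2"
proof -
  define P where "P = F - 2 * a + 4 * b * r"
  define E where "E = - 6 * d + 2 * a * r - r * F"
  have ne: "P \<noteq> 0" "E \<noteq> 0" using assms by (auto simp: P_def E_def)
  have lamE: "F4 = - E * u * lam" using ne u unfolding lam_def E_def[symmetric] by simp
  have 2: "P * lam2 = (3 * d - 2 * b * r\<^sup>2) / r * lam - 2 * (2 * b * r\<^sup>2 - d) / r * (ux / u)"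
    using ne r u unfolding lam2_def P_def[symmetric] E_def[symmetric] lamE
    by (simp add: field_simps)
  have "lam1 = - (8 * b * (- d + 2 * b * r\<^sup>2) * ux / (r\<^sup>2 * u * P))
      - (- d * P - 12 * b * d * r + 8 * b\<^sup>2 * r ^ 3) * lam / (r ^ 3 * P)"
  proof -
    have num: "2 * a * d - 16 * b * d * r + 8 * b\<^sup>2 * r ^ 3 - d * F = - d * P - 12 * b * d * r + 8 * b\<^sup>2 * r ^ 3"
      by (simp add: P_def algebra_simps)
    show ?thesis
      using ne r u unfolding lam1_def P_def[symmetric] E_def[symmetric] lamE num by simp
  qed
  also have "\<dots> = d / r ^ 3 * lam + 4 * b / (r * P) * (P * lam2)"
    unfolding 2 using ne r u by (simp add: field_simps power2_eq_square power3_eq_cube)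
  finally have 1: "lam1 = d / r ^ 3 * lam + 4 * b / r * lam2" using ne by simp
  show "0 = - (RT_gtt'' d r / 4) * lam + lam1 - (4 * b / r) * lam2"
    unfolding 1 RT_gtt''_def by simp
  have "(r * RT_gtt' b d r / 2) * lam - 2 * r\<^sup>2 * lam1 + (F - 2 * a + 12 * b * r) * lam2
    = (2 * b * r - 3 * d / r) * lam + P * lam2"
    unfolding 1 RT_gtt'_def P_def using r by (simp add: field_simps power2_eq_square power3_eq_cube)
  also have "\<dots> = - (r * RT_gtt' b d r * ux / u)"
    unfolding 2 RT_gtt'_def using r u by (simp add: field_simps power2_eq_square)
  finally show "- (r * RT_gtt' b d r * ux / u) = (r * RT_gtt' b d r / 2) * lam - 2 * r\<^sup>2 * lam1
      + (F - 2 * a + 12 * b * r) * lam2" ..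
  have "- (r\<^sup>2 * (F + RT_gtt a b d r) / 2) * lam + r ^ 4 * lam1 - r\<^sup>2 * (F - 2 * a + 8 * b * r) * lam2
    = (- (r\<^sup>2 * (F + RT_gtt a b d r) / 2) + r * d) * lam - r\<^sup>2 * (P * lam2)"
    unfolding 1 P_def using r by (simp add: field_simps power2_eq_square power3_eq_cube power4_eq_xxxx)
  also have "\<dots> = r * E / 2 * lam + 2 * r * (2 * b * r\<^sup>2 - d) * (ux / u)"
    unfolding 2 RT_gtt_def E_def using r u by (simp add: field_simps power2_eq_square)
  also have "r * E / 2 * lam = - (r * F4 / (2 * u))"
    unfolding lamE using u by simp
  also have "- (r * F4 / (2 * u)) + 2 * r * (2 * b * r\<^sup>2 - d) * (ux / u) =
    2 * r\<^sup>2 * (F + RT_gtt a b d r) * ux / u - r\<^sup>2 * F' / 2"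
    unfolding F4_def RT_gtt_def using r u by (simp add: field_simps power2_eq_square)
  finally show "2 * r\<^sup>2 * (F + RT_gtt a b d r) * ux / u - r\<^sup>2 * F' / 2 =
      - (r\<^sup>2 * (F + RT_gtt a b d r) / 2) * lam + r ^ 4 * lam1 - r\<^sup>2 * (F - 2 * a + 8 * b * r) * lam2" ..
qed

theorem proposition4p2:
  fixes a b d :: real
    and I J :: "real set"
    and \<Omega> :: "(real^2) set"
    and f :: "real^2 \<Rightarrow> real"
  assumes "open I" and "is_interval I"
    and "open J" and "is_interval J" and "0 \<notin> J"
    and "open \<Omega>" and "connected \<Omega>" and "\<Omega> \<noteq> {}"
    and "smooth_on \<Omega> f" and "\<forall>z\<in>\<Omega>. f z \<noteq> 0"
    and "\<forall>p\<in>RT_domain I J \<Omega>. RT_F1 f (xy p) - 2 * a + 4 * b * p $ 2 \<noteq> 0"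
    and "\<forall>p\<in>RT_domain I J \<Omega>. p $ 2 * RT_F1 f (xy p) + 6 * d - 2 * a * p $ 2 \<noteq> 0"
  shows "generalized_curvature_inheritance (RT_domain I J \<Omega>) (RT_metric a b d f)
           (\<lambda>_. axis 3 1) (RT_lam a b d f) (RT_lam1 a b d f) (RT_lam2 a b d f)"
proof -
  interpret robinson_trautman a b d I J \<Omega> f
    by standard (use assms in auto)
  have P: "RT_F1 f (xy p) - 2 * a + 4 * b * p $ 2 \<noteq> 0" if "p \<in> M" for p
    using assms(11) that by blast
  have E: "- 6 * d + 2 * a * p $ 2 - p $ 2 * RT_F1 f (xy p) \<noteq> 0" if "p \<in> M" for p
  proof
    assume "- 6 * d + 2 * a * p $ 2 - p $ 2 * RT_F1 f (xy p) = 0"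
    then have "p $ 2 * RT_F1 f (xy p) + 6 * d - 2 * a * p $ 2 = 0" by simp
    then show False using assms(12) that by blast
  qed
  have smooth_M: "smooth_on M (\<lambda>p. h (xy p))" if "smooth_on \<Omega> h" for h
    by (rule smooth_on_xy[OF open_M that M_D(2)])
  have f: "smooth_on M (\<lambda>p. f (xy p))" and fx: "smooth_on M (\<lambda>p. partial 1 f (xy p))"
    by (intro smooth_M smooth_f smooth_on_partial)+
  have F1: "smooth_on M (\<lambda>p. RT_F1 f (xy p))"
    unfolding RT_F1_def Let_def
    by (intro smooth_on_add smooth_on_diff smooth_on_mult smooth_on_power smooth_M smooth_on_partial smooth_f open_M)
  have F4: "smooth_on M (\<lambda>p. RT_F4 a b d f (p $ 2) (xy p))"
    unfolding RT_F4_def Let_def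
    by (intro smooth_on_intros open_M smooth_M[OF smooth_f] smooth_M[OF smooth_on_partial] smooth_on_partial smooth_f)
  have "smooth_on M (RT_lam a b d f)"
    unfolding RT_lam_def[abs_def] Let_def
    by (intro smooth_on_intros open_M f F1 F4) (use M_D E in auto)
  moreover have "smooth_on M (RT_lam1 a b d f)"
    unfolding RT_lam1_def[abs_def] Let_def
    by (intro smooth_on_intros open_M f fx F1 F4) (use M_D P E in auto)
  moreover have "smooth_on M (RT_lam2 a b d f)"
    unfolding RT_lam2_def[abs_def] Let_def
    by (intro smooth_on_intros open_M f fx F1 F4) (use M_D P E in auto)
  moreover have "lie_derivative (\<lambda>_. axis 3 1) (riemann g) p i j k l =
      RT_lam a b d f p * riemann g p i j k l + RT_lam1 a b d f p * kulkarni_nomizu g g p i j k l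
      + RT_lam2 a b d f p * kulkarni_nomizu g (ricci g) p i j k l" if p: "p \<in> M" for p i j k l
  proof -
    define r where "r = p $ 2"
    let ?GG = "kulkarni_nomizu \<gamma> \<gamma> p i j k l" and ?GS = "kulkarni_nomizu \<gamma> \<sigma> p i j k l"
      and ?SS = "kulkarni_nomizu \<sigma> \<sigma> p i j k l"
    have sym: "\<gamma> p $ i $ j = \<gamma> p $ j $ i" "\<sigma> p $ i $ j = \<sigma> p $ j $ i" for i j
      unfolding RT_gamma_def RT_sigma_def by (rule block_sym)+
    have g: "g p $ i $ j = \<gamma> p $ i $ j + (- (r\<^sup>2)) * \<sigma> p $ i $ j" for i j
      by (simp add: RT_metric_split r_def)
    have g1: "g p $ i $ j = 1 * \<gamma> p $ i $ j + (- (r\<^sup>2)) * \<sigma> p $ i $ j" for i j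
      by (simp add: g)
    have gg: "kulkarni_nomizu g g p i j k l = ?GG - 2 * r\<^sup>2 * ?GS + r ^ 4 * ?SS"
      using kulkarni_nomizu_combination[where g = g and S = g and \<gamma> = \<gamma> and \<sigma> = \<sigma>, OF g g1 sym, of i j k l]
      by (simp add: power2_eq_square power4_eq_xxxx)
    have gS: "kulkarni_nomizu g (ricci g) p i j k l = - (4 * b / r) * ?GG
        + (RT_F1 f (xy p) - 2 * a + 12 * b * r) * ?GS - r\<^sup>2 * (RT_F1 f (xy p) - 2 * a + 8 * b * r) * ?SS"
      using kulkarni_nomizu_combination[where g = g and S = "ricci g" and \<gamma> = \<gamma> and \<sigma> = \<sigma>, OF g ricci_RT[OF p, folded r_def] sym, of i j k l] M_D(1)[OF p]
      by (simp add: power2_eq_square r_def)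
    let ?F = "RT_F1 f (xy p)" and ?u = "f (xy p)" and ?ux = "partial 1 f (xy p)"
    let ?F' = "partial 1 (RT_F1 f) (xy p)"
    let ?l = "RT_lam a b d f p" and ?l1 = "RT_lam1 a b d f p" and ?l2 = "RT_lam2 a b d f p"
    note coefficients = inheritance_coefficients[where F' = ?F' and ux = ?ux,
        OF M_D(1,3)[OF p] P[OF p] E[OF p]]
    have GG: "0 = - (A'' r / 4) * ?l + ?l1 - (4 * b / r) * ?l2"
      unfolding RT_lam_def RT_lam1_def RT_lam2_def Let_def r_def F4_eq[OF M_D(2)[OF p]]
      by (fact coefficients(1))
    have GS: "- (r * A' r * ?ux / ?u) = (r * A' r / 2) * ?l - 2 * r\<^sup>2 * ?l1 + (?F - 2 * a + 12 * b * r) * ?l2"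
      unfolding RT_lam_def RT_lam1_def RT_lam2_def Let_def r_def F4_eq[OF M_D(2)[OF p]]
      by (fact coefficients(2))
    have SS: "2 * r\<^sup>2 * (?F + A r) * ?ux / ?u - r\<^sup>2 * ?F' / 2 =
        - (r\<^sup>2 * (?F + A r) / 2) * ?l + r ^ 4 * ?l1 - r\<^sup>2 * (?F - 2 * a + 8 * b * r) * ?l2"
      unfolding RT_lam_def RT_lam1_def RT_lam2_def Let_def r_def F4_eq[OF M_D(2)[OF p]]
      by (fact coefficients(3))
    have "?l * riemann g p i j k l + ?l1 * kulkarni_nomizu g g p i j k l + ?l2 * kulkarni_nomizu g (ricci g) p i j k l
      = (- (A'' r / 4) * ?l + ?l1 - (4 * b / r) * ?l2) * ?GG
        + ((r * A' r / 2) * ?l - 2 * r\<^sup>2 * ?l1 + (?F - 2 * a + 12 * b * r) * ?l2) * ?GS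
        + (- (r\<^sup>2 * (?F + A r) / 2) * ?l + r ^ 4 * ?l1 - r\<^sup>2 * (?F - 2 * a + 8 * b * r) * ?l2) * ?SS"
      unfolding riemann_RT[OF p, folded r_def] gg gS by (simp add: algebra_simps)
    then show ?thesis
      unfolding GG[symmetric] GS[symmetric] SS[symmetric]
        lie_derivative_riemann_RT[OF p, folded r_def] by simp
  qed
  ultimately show ?thesis
    unfolding generalized_curvature_inheritance_def by blast
qed

end
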